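(* Assume $\rho=\tau$, so that $\rho'=\infty$. For the approximation problem on the cones $\mathcal{C}_d$, $d\in\mathbb{N}$, the following hold. 1. The problem is strongly polynomially tractable if and only if there exist $\eta>0$ and $i_0\in\mathbb{N}$ such that $$\sup_{d\in\mathbb{N}}\sum_{i=i_0}^\infty\lambda_{d,\boldsymbol{k}_i}^{\eta}<\infty.\qquad( * )$$ Furthermore, the exponent of strong polynomial tractability is then equal to the infimum of those $\eta>0$ for which $( * )$ holds (for some $i_0\in\mathbb{N}$). 2. The problem is polynomially tractable if and only if there exist $\eta_1,\eta_2\ge0$ and $\eta_3,K>0$ such that $$\sup_{d\in\mathbb{N}}d^{-\eta_1}\sum_{i=\lceil Kd^{\eta_2}\rceil}^\infty\lambda_{d,\boldsymbol{k}_i}^{\eta_3}<\infty.$$ 3. The problem is weakly tractable if and only if $$\sup_{d\in\mathbb{N}}\exp(-cd)\sum_{i=1}^\infty\exp\Bigl(-\frac{c}{\lambda_{d,\boldsymbol{k}_i}}\Bigr)<\infty\quad\text{for all }c>0.$$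
   Context: Setting. For each $d\in\mathbb{N}$ (dimension of the domain of the input functions), let $\mathbb{K}_d$ be a countably infinite index set, with positive weights enumerated so that $\lambda_{d,\boldsymbol{k}_1}\ge\lambda_{d,\boldsymbol{k}_2}\ge\cdots>0$ (the enumeration $\boldsymbol{k}_1,\boldsymbol{k}_2,\dots$ of $\mathbb{K}_d$ depends on $d$). Let $1\le\tau\le\rho\le\infty$ and $\rho'\in[\tau,\infty]$ with $1/\rho+1/\rho'=1/\tau$; it is assumed that $\|(\lambda_{d,\boldsymbol{k}_i})_{i\ge1}\|_{\rho'}<\infty$ for each $d$. $\|\cdot\|_p$ is the $\ell^p$ norm. The input and output Banach spaces, with bases $\{u_{\boldsymbol{k}}\}$ and $\{v_{\boldsymbol{k}}\}$ (elements are identified with their coefficient sequences), are $$\mathcal{F}_d=\Bigl\{f=\sum_{\boldsymbol{k}\in\mathbb{K}_d}\widehat f(\boldsymbol{k})u_{\boldsymbol{k}}:\|f\|_{\mathcal{F}_d}:=\bigl\|(\widehat f(\boldsymbol{k})/\lambda_{d,\boldsymbol{k}})_{\boldsymbol{k}}\bigr\|_\rho<\infty\Bigr\},\quad \mathcal{G}_d=\Bigl\{g=\sum_{\boldsymbol{k}\in\mathbb{K}_d}\widehat g(\boldsymbol{k})v_{\boldsymbol{k}}:\|g\|_{\mathcal{G}_d}:=\bigl\|(\widehat g(\boldsymbol{k}))_{\boldsymbol{k}}\bigr\|_\tau<\infty\Bigr\},$$ and $\mathrm{SOL}_d:\mathcal{F}_d\to\mathcal{G}_d$, $\mathrm{SOL}_d(f)=\sum_{\boldsymbol{k}}\widehat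 f(\boldsymbol{k})v_{\boldsymbol{k}}$. Fix $A>1$ and $n_1\in\mathbb{N}$, independent of $d$, and let $$\mathcal{C}_d=\Bigl\{f\in\mathcal{F}_d:\|f\|_{\mathcal{F}_d}\le A\bigl\|(\widehat f(\boldsymbol{k}_i)/\lambda_{d,\boldsymbol{k}_i})_{i=1}^{n_1}\bigr\|_\rho\Bigr\}.$$ $\mathcal{A}(\mathcal{C}_d)$ is the set of all (deterministic) algorithms $\mathrm{ALG}$ that use only finitely many series coefficients of the input (the number and choice of which may depend adaptively on the coefficient values already observed and on $\varepsilon$) and satisfy $\|\mathrm{SOL}_d(f)-\mathrm{ALG}(f,\varepsilon)\|_{\mathcal{G}_d}\le\varepsilon$ for all $\varepsilon>0$, $f\in\mathcal{C}_d$. $\mathrm{COST}(\mathrm{ALG},f,\varepsilon)$ is the number of coefficients used by $\mathrm{ALG}(f,\varepsilon)$, and $$\mathrm{COMP}(\mathcal{A}(\mathcal{C}_d),\varepsilon,R)=\min_{\mathrm{ALG}\in\mathcal{A}(\mathcal{C}_d)}\ \max_{f\in\mathcal{C}_d,\ \|f\|_{\mathcal{F}_d}\le R}\mathrm{COST}(\mathrm{ALG},f,\varepsilon).$$ Tractability notions. Strongly polynomially tractable: there are non-negative $C,p,\varepsilon_{\max},R_{\min}$ (with $\varepsilon_{\max},R_{\min}>0$) such that $\mathrm{COMP}(\mathcal{A}(\mathcal{C}_d),\varepsilon,R)\le C R^p\varepsilon^{-p}$ for all $d\in\mathbb{N}$, $\varepsilon\in(0,\varepsilon_{\max}]$, $R\in[R_{\min},\infty)$;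 the infimum of such $p$ is the exponent of strong polynomial tractability. Polynomially tractable: there are non-negative $C,p,q,\varepsilon_{\max},R_{\min}$ (with $\varepsilon_{\max},R_{\min}>0$) such that $\mathrm{COMP}(\mathcal{A}(\mathcal{C}_d),\varepsilon,R)\le C d^qR^p\varepsilon^{-p}$ for all such $d,\varepsilon,R$. Weakly tractable: $$\lim_{d+R\varepsilon^{-1}\to\infty}\frac{\log\mathrm{COMP}(\mathcal{A}(\mathcal{C}_d),\varepsilon,R)}{d+R\varepsilon^{-1}}=0.$$ *)

theory Defs
  imports "HOL-Analysis.Analysis" "HOL-Library.Extended_Nat"
begin

section \<open>Extended-valued \<open>\<ell>\<^sup>p\<close> norms\<close>

text \<open>The norm is \<open>\<infinity>\<close> on families that are not in \<open>\<ell>\<^sup>p\<close>. The unrestricted sum is taken in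
  \<^typ>\<open>ennreal\<close>, where it always exists. Only exponents \<open>1 \<le> p \<le> \<infinity>\<close> are meant.\<close>

definition lp_norm :: "ennreal \<Rightarrow> 'i set \<Rightarrow> ('i \<Rightarrow> 'b::real_normed_vector) \<Rightarrow> ennreal" where
  "lp_norm p S x =
     (if p = \<infinity> then (SUP i\<in>S. ennreal (norm (x i)))
      else (let s = (\<Sum>\<^sub>\<infinity>i\<in>S. ennreal (norm (x i) powr enn2real p))
            in if s = \<infinity> then \<infinity> else ennreal (enn2real s powr (1 / enn2real p))))"


section \<open>Input space, output space, cone\<close>

text \<open>Elements of the Banach spaces are identified with their coefficient families with respect
  to the bases \<open>u\<close> and \<open>v\<close>: functions on the index type that vanish off the index set \<open>K\<close>.
  The scalars form a \<^class>\<open>real_normed_field\<close>, so real and complex coefficients are both covered.\<close>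

definition coeff_families :: "'k set \<Rightarrow> ('k \<Rightarrow> 'a::real_normed_field) set" where
  "coeff_families K = {f. \<forall>k. k \<notin> K \<longrightarrow> f k = 0}"

definition F_norm :: "ennreal \<Rightarrow> 'k set \<Rightarrow> ('k \<Rightarrow> real) \<Rightarrow> ('k \<Rightarrow> 'a::real_normed_field) \<Rightarrow> ennreal" where
  "F_norm \<rho> K w f = lp_norm \<rho> K (\<lambda>k. f k /\<^sub>R w k)"

definition F_space :: "ennreal \<Rightarrow> 'k set \<Rightarrow> ('k \<Rightarrow> real) \<Rightarrow> ('k \<Rightarrow> 'a::real_normed_field) set" where
  "F_space \<rho> K w = {f \<in> coeff_families K. F_norm \<rho> K w f < \<infinity>}"

definition G_norm :: "ennreal \<Rightarrow> 'k set \<Rightarrow> ('k \<Rightarrow> 'a::real_normed_field) \<Rightarrow> ennreal" where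
  "G_norm \<tau> K g = lp_norm \<tau> K g"

definition G_space :: "ennreal \<Rightarrow> 'k set \<Rightarrow> ('k \<Rightarrow> 'a::real_normed_field) set" where
  "G_space \<tau> K = {g \<in> coeff_families K. G_norm \<tau> K g < \<infinity>}"

text \<open>The solution operator maps \<open>\<Sum>\<^sub>k f k u\<^sub>k\<close> to \<open>\<Sum>\<^sub>k f k v\<^sub>k\<close>, hence leaves the coefficients unchanged.\<close>

definition SOL :: "('k \<Rightarrow> 'a::real_normed_field) \<Rightarrow> ('k \<Rightarrow> 'a)" where
  "SOL f = f"

text \<open>\<open>e i\<close> is the \<open>i\<close>-th index, \<open>i = 1, 2, \<dots>\<close>, in the order of decreasing weights.\<close>

definition cone ::
  "ennreal \<Rightarrow> real \<Rightarrow> nat \<Rightarrow> 'k set \<Rightarrow> ('k \<Rightarrow> real) \<Rightarrow> (nat \<Rightarrow> 'k) \<Rightarrow> ('k \<Rightarrow> 'a::real_normed_field) set" where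
  "cone \<rho> A n\<^sub>1 K w e =
     {f \<in> F_space \<rho> K w.
        F_norm \<rho> K w f \<le> ennreal A * lp_norm \<rho> {1..n\<^sub>1} (\<lambda>i. f (e i) /\<^sub>R w (e i))}"


section \<open>Adaptive algorithms and complexity\<close>

text \<open>For a given tolerance, an algorithm looks at the list of coefficients observed so far
  (with their indices) and either asks for one more coefficient or stops with an output.\<close>

datatype ('k, 'a) decision = Query 'k | Output "'k \<Rightarrow> 'a"

type_synonym ('k, 'a) algorithm = "real \<Rightarrow> ('k \<times> 'a) list \<Rightarrow> ('k, 'a) decision"

primrec history :: "('k, 'a) algorithm \<Rightarrow> ('k \<Rightarrow> 'a) \<Rightarrow> real \<Rightarrow> nat \<Rightarrow> ('k \<times> 'a) list" where
  "history ALG f \<epsilon> 0 = []"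
| "history ALG f \<epsilon> (Suc n) =
     (case ALG \<epsilon> (history ALG f \<epsilon> n) of
        Query k \<Rightarrow> history ALG f \<epsilon> n @ [(k, f k)]
      | Output g \<Rightarrow> history ALG f \<epsilon> n)"

definition stops_at :: "('k, 'a) algorithm \<Rightarrow> ('k \<Rightarrow> 'a) \<Rightarrow> real \<Rightarrow> nat \<Rightarrow> bool" where
  "stops_at ALG f \<epsilon> n \<longleftrightarrow> (\<exists>g. ALG \<epsilon> (history ALG f \<epsilon> n) = Output g)"

definition halts :: "('k, 'a) algorithm \<Rightarrow> ('k \<Rightarrow> 'a) \<Rightarrow> real \<Rightarrow> bool" where
  "halts ALG f \<epsilon> \<longleftrightarrow> (\<exists>n. stops_at ALG f \<epsilon> n)"

text \<open>The next three notions are meaningful only if \<open>halts ALG f \<epsilon>\<close>.\<close>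

definition final_history :: "('k, 'a) algorithm \<Rightarrow> ('k \<Rightarrow> 'a) \<Rightarrow> real \<Rightarrow> ('k \<times> 'a) list" where
  "final_history ALG f \<epsilon> = history ALG f \<epsilon> (LEAST n. stops_at ALG f \<epsilon> n)"

definition result :: "('k, 'a) algorithm \<Rightarrow> ('k \<Rightarrow> 'a) \<Rightarrow> real \<Rightarrow> ('k \<Rightarrow> 'a)" where
  "result ALG f \<epsilon> = (THE g. ALG \<epsilon> (final_history ALG f \<epsilon>) = Output g)"

definition used_indices :: "('k, 'a) algorithm \<Rightarrow> ('k \<Rightarrow> 'a) \<Rightarrow> real \<Rightarrow> 'k set" where
  "used_indices ALG f \<epsilon> = fst ` set (final_history ALG f \<epsilon>)"

definition COST :: "('k, 'a) algorithm \<Rightarrow> ('k \<Rightarrow> 'a) \<Rightarrow> real \<Rightarrow> nat" where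
  "COST ALG f \<epsilon> = card (used_indices ALG f \<epsilon>)"

text \<open>Halting is demanded only for inputs in \<open>\<C>\<close>.\<close>

definition algorithms ::
  "ennreal \<Rightarrow> 'k set \<Rightarrow> ('k \<Rightarrow> 'a::real_normed_field) set \<Rightarrow> ('k, 'a) algorithm set" where
  "algorithms \<tau> K \<C> =
     {ALG. \<forall>\<epsilon>>0. \<forall>f\<in>\<C>. halts ALG f \<epsilon> \<and> used_indices ALG f \<epsilon> \<subseteq> K \<and> result ALG f \<epsilon> \<in> G_space \<tau> K \<and>
        G_norm \<tau> K (\<lambda>k. SOL f k - result ALG f \<epsilon> k) \<le> ennreal \<epsilon>}"

text \<open>Minimum and maximum are taken in \<^typ>\<open>enat\<close>: the value is \<open>\<infinity>\<close> if there is no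
  admissible algorithm, or if the cost of every admissible algorithm is unbounded. The argument of
  type \<^typ>\<open>'a itself\<close> fixes the scalar field.\<close>

definition COMP ::
  "'a::real_normed_field itself \<Rightarrow> ennreal \<Rightarrow> ennreal \<Rightarrow> real \<Rightarrow> nat
     \<Rightarrow> 'k set \<Rightarrow> ('k \<Rightarrow> real) \<Rightarrow> (nat \<Rightarrow> 'k) \<Rightarrow> real \<Rightarrow> real \<Rightarrow> enat" where
  "COMP (_ :: 'a itself) \<rho> \<tau> A n\<^sub>1 K w e \<epsilon> R =
     (let \<C> = (cone \<rho> A n\<^sub>1 K w e :: ('k \<Rightarrow> 'a) set)
      in INF ALG\<in>algorithms \<tau> K \<C>.
           SUP f\<in>{f \<in> \<C>. F_norm \<rho> K w f \<le> ennreal R}. enat (COST ALG f \<epsilon>))"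


section \<open>Tractability\<close>

text \<open>Here \<open>cpx d \<epsilon> R\<close> is the complexity in dimension \<open>d \<ge> 1\<close>.\<close>

definition spt_with_exponent :: "(nat \<Rightarrow> real \<Rightarrow> real \<Rightarrow> enat) \<Rightarrow> real \<Rightarrow> bool" where
  "spt_with_exponent cpx p \<longleftrightarrow> p \<ge> 0 \<and>
     (\<exists>C \<epsilon>max Rmin. C \<ge> 0 \<and> \<epsilon>max > 0 \<and> Rmin > 0 \<and>
        (\<forall>d\<ge>1. \<forall>\<epsilon>\<in>{0<..\<epsilon>max}. \<forall>R\<ge>Rmin.
           ereal_of_enat (cpx d \<epsilon> R) \<le> ereal (C * R powr p * \<epsilon> powr (- p))))"

definition strongly_polynomially_tractable :: "(nat \<Rightarrow> real \<Rightarrow> real \<Rightarrow> enat) \<Rightarrow> bool" where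
  "strongly_polynomially_tractable cpx \<longleftrightarrow> (\<exists>p. spt_with_exponent cpx p)"

definition spt_exponent :: "(nat \<Rightarrow> real \<Rightarrow> real \<Rightarrow> enat) \<Rightarrow> real" where
  "spt_exponent cpx = Inf {p. spt_with_exponent cpx p}"

definition polynomially_tractable :: "(nat \<Rightarrow> real \<Rightarrow> real \<Rightarrow> enat) \<Rightarrow> bool" where
  "polynomially_tractable cpx \<longleftrightarrow>
     (\<exists>C p q \<epsilon>max Rmin. C \<ge> 0 \<and> p \<ge> 0 \<and> q \<ge> 0 \<and> \<epsilon>max > 0 \<and> Rmin > 0 \<and>
        (\<forall>d\<ge>1. \<forall>\<epsilon>\<in>{0<..\<epsilon>max}. \<forall>R\<ge>Rmin.
           ereal_of_enat (cpx d \<epsilon> R) \<le> ereal (C * real d powr q * R powr p * \<epsilon> powr (- p))))"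

definition ln_enat :: "enat \<Rightarrow> ereal" where
  "ln_enat n = (case n of enat m \<Rightarrow> (if m = 0 then -\<infinity> else ereal (ln (real m))) | \<infinity> \<Rightarrow> \<infinity>)"

text \<open>The limit is along \<open>d + R / \<epsilon> \<longlongrightarrow> \<infinity>\<close>, jointly in all \<open>d \<ge> 1\<close>, \<open>\<epsilon> > 0\<close>, \<open>R > 0\<close>.\<close>

definition weakly_tractable :: "(nat \<Rightarrow> real \<Rightarrow> real \<Rightarrow> enat) \<Rightarrow> bool" where
  "weakly_tractable cpx \<longleftrightarrow>
     ((\<lambda>(d, \<epsilon>, R). ln_enat (cpx d \<epsilon> R) / ereal (real d + R / \<epsilon>)) \<longlongrightarrow> 0)
       (inf (filtercomap (\<lambda>(d, \<epsilon>, R). real d + R / \<epsilon>) at_top)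
            (principal {(d, \<epsilon>, R). d \<ge> 1 \<and> \<epsilon> > 0 \<and> R > 0}))"

end

theory Submission
  imports Defs
begin

text \<open>
  Write \<open>\<lambda>\<^sub>i\<close> for the weights in decreasing order, in some fixed dimension. The proof has two halves:
  the complexity essentially counts the weights above \<open>\<epsilon> / R\<close>, and the three tractability notions
  translate growth conditions on this count into summability conditions on the weights.

  \<^bold>\<open>Counting.\<close> For inputs in the cone, the norm is bounded by \<open>A\<close> times the norm \<open>N\<close> of the \<open>n\<^sub>1\<close>
  leading coefficients, which can be observed. As the exponents of the two norms agree, dropping
  all coefficients beyond the \<open>n\<close>-th causes an error of at most \<open>\<lambda>\<^sub>n\<^sub>+\<^sub>1\<close> times the norm of the input.
  Reading coefficients in order until \<open>\<lambda>\<^sub>n\<^sub>+\<^sub>1 A N \<le> \<epsilon>\<close> is therefore a correct algorithm; on inputs of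
  norm at most \<open>R\<close> it stops, apart from the first \<open>n\<^sub>1\<close> coefficients, after those with
  \<open>\<lambda>\<^sub>i > \<epsilon> / (A R)\<close> (\<open>COMP_upper_bound\<close>). Conversely, take as input a single coefficient at the
  largest weight, of norm \<open>R / A\<close>. Adding a further coefficient at an unobserved index \<open>i > n\<^sub>1\<close>, with
  either sign and norm \<open>(A - 1) R / A\<close>, stays in the cone and in the ball of radius \<open>R\<close>, and the two
  results are too far apart for a common output if \<open>\<lambda>\<^sub>i > A / (A - 1) \<epsilon> / R\<close>. So all these indices
  must be observed (\<open>COMP_lower_bound\<close>).

  \<^bold>\<open>Summation.\<close> The locale \<open>cost_sandwich\<close> abstracts from the approximation problem and keeps only
  these two bounds. If a sum over an increasing positive function \<open>g\<close> of the weights is bounded, the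
  number of weights above \<open>t\<close> is at most a constant times \<open>1 / g t\<close> (\<open>count_le_of_sum_le\<close>); with
  \<open>g t = t powr \<eta>\<close> and \<open>g t = exp (- c / t)\<close> this yields the upper bounds on the cost. In the other
  direction, a bound on the number of weights above \<open>t\<close>, read at \<open>t\<close> slightly below \<open>\<lambda>\<^sub>i\<close>, bounds \<open>i\<close>
  itself. For polynomial bounds this is \<open>\<lambda>\<^sub>i = O(i powr (- 1 / p))\<close>, so that the powers with exponent
  \<open>\<eta> > p\<close> are summable (\<open>powr_sum_le_of_cost_le\<close>); for exponential bounds, \<open>exp (- c / \<lambda>\<^sub>i)\<close> is
  compared with \<open>1 / i\<^sup>2\<close>. In both cases the comparison series does not depend on the dimension.
\<close>

section \<open>Norms of coefficient families\<close>

lemma ennreal_family_summable_on: "(f :: 'i \<Rightarrow> ennreal) summable_on S"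
  by (rule nonneg_summable_on_complete) simp

lemma sum_le_infsum_ennreal:
  fixes f :: "'i \<Rightarrow> ennreal"
  assumes "finite F" "F \<subseteq> S"
  shows "sum f F \<le> infsum f S"
proof -
  have "infsum f S = (SUP F\<in>{F. finite F \<and> F \<subseteq> S}. sum f F)"
    by (rule nonneg_infsum_complete) simp
  then show ?thesis using assms by (auto intro!: SUP_upper)
qed

lemma infsum_cmult_le_ennreal:
  fixes f :: "'i \<Rightarrow> ennreal"
  shows "infsum (\<lambda>i. c * f i) S \<le> c * infsum f S"
proof (rule infsum_le_finite_sums)
  fix F assume "finite F" "F \<subseteq> S"
  then show "(\<Sum>i\<in>F. c * f i) \<le> c * infsum f S"
    unfolding sum_distrib_left[symmetric] by (intro mult_left_mono sum_le_infsum_ennreal) auto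
qed (rule ennreal_family_summable_on)

text \<open>For a finite exponent the norm is this monotone function of the sum of \<open>q\<close>-th
  powers, and its behaviour under scaling is that of a root.\<close>

definition lp_root :: "real \<Rightarrow> ennreal \<Rightarrow> ennreal" where
  "lp_root q s = (if s = \<infinity> then \<infinity> else ennreal (enn2real s powr (1 / q)))"

lemma lp_norm_eq_lp_root:
  "p \<noteq> \<infinity> \<Longrightarrow> lp_norm p S x =
     lp_root (enn2real p) (\<Sum>\<^sub>\<infinity>i\<in>S. ennreal (norm (x i) powr enn2real p))"
  by (simp add: lp_norm_def lp_root_def Let_def)

lemma lp_root_mono:
  assumes "q > 0" "s \<le> t"
  shows "lp_root q s \<le> lp_root q t"
proof (cases "t = \<infinity>")
  case False
  then have "t < top" by (simp add: less_top)
  moreover have "s < top" using calculation assms(2) by (rule order.strict_trans1[rotated])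
  ultimately have "enn2real s powr (1/q) \<le> enn2real t powr (1/q)"
    using assms by (intro powr_mono2 enn2real_mono) auto
  then show ?thesis using \<open>t < top\<close> \<open>s < top\<close> by (auto simp: lp_root_def intro: ennreal_leI)
qed (simp add: lp_root_def)

lemma lp_root_powr: "q > 0 \<Longrightarrow> c \<ge> 0 \<Longrightarrow> lp_root q (ennreal (c powr q)) = ennreal c"
  by (simp add: lp_root_def powr_powr)

lemma lp_root_scale:
  assumes "q > 0" "c > 0"
  shows "lp_root q (ennreal (c powr q) * s) = ennreal c * lp_root q s"
proof (cases s)
  case (real r)
  then show ?thesis using assms
    by (simp add: lp_root_def ennreal_mult'[symmetric] ennreal_mult[symmetric] powr_mult powr_powr)
next
  case top
  then show ?thesis using assms by (simp add: lp_root_def ennreal_mult_top)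
qed

lemma enn2real_ge_1: "1 \<le> p \<Longrightarrow> p \<noteq> \<infinity> \<Longrightarrow> 1 \<le> enn2real p"
  by (metis enn2real_1 enn2real_mono infinity_ennreal_def less_top)

lemma lp_norm_cong: "(\<And>i. i \<in> S \<Longrightarrow> x i = y i) \<Longrightarrow> lp_norm p S x = lp_norm p S y"
  by (simp add: lp_norm_def cong: infsum_cong image_cong)

lemma norm_le_lp_norm:
  assumes "1 \<le> p" "i \<in> S"
  shows "ennreal (norm (x i)) \<le> lp_norm p S x"
proof (cases "p = \<infinity>")
  case True
  then show ?thesis using assms by (auto simp: lp_norm_def intro!: SUP_upper)
next
  case False
  define q where "q = enn2real p"
  have q: "q > 0" using enn2real_ge_1[OF assms(1) False] by (simp add: q_def)
  have "ennreal (norm (x i) powr q) \<le> (\<Sum>\<^sub>\<infinity>i\<in>S. ennreal (norm (x i) powr q))"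
    using sum_le_infsum_ennreal[of "{i}" S "\<lambda>i. ennreal (norm (x i) powr q)"] assms by simp
  from lp_root_mono[OF q this] show ?thesis
    using q by (simp add: lp_norm_eq_lp_root[OF False] q_def[symmetric] lp_root_powr)
qed

lemma lp_norm_scale_mono:
  assumes "1 \<le> p" "c > 0" "\<And>i. i \<in> S \<Longrightarrow> norm (x i) \<le> c * norm (y i)"
  shows "lp_norm p S x \<le> ennreal c * lp_norm p S y"
proof (cases "p = \<infinity>")
  case True
  have "ennreal (norm (x i)) \<le> ennreal c * (SUP i\<in>S. ennreal (norm (y i)))" if "i \<in> S" for i
  proof -
    have "ennreal (norm (x i)) \<le> ennreal c * ennreal (norm (y i))"
      using assms(2) assms(3)[OF that] by (simp add: ennreal_mult[symmetric] ennreal_leI)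
    also have "\<dots> \<le> ennreal c * (SUP i\<in>S. ennreal (norm (y i)))"
      using that by (intro mult_left_mono SUP_upper) auto
    finally show ?thesis .
  qed
  then show ?thesis using True by (auto simp: lp_norm_def intro!: SUP_least)
next
  case False
  define q where "q = enn2real p"
  have q: "q > 0" using enn2real_ge_1[OF assms(1) False] by (simp add: q_def)
  have "(\<Sum>\<^sub>\<infinity>i\<in>S. ennreal (norm (x i) powr q))
      \<le> (\<Sum>\<^sub>\<infinity>i\<in>S. ennreal (c powr q) * ennreal (norm (y i) powr q))"
  proof (rule infsum_mono_neutral)
    fix i assume "i \<in> S \<inter> S"
    then have "norm (x i) powr q \<le> (c * norm (y i)) powr q"
      using assms(3) q by (intro powr_mono2) auto
    then show "ennreal (norm (x i) powr q) \<le> ennreal (c powr q) * ennreal (norm (y i) powr q)"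
      using assms(2) by (simp add: powr_mult ennreal_mult[symmetric] ennreal_leI)
  qed (auto intro: ennreal_family_summable_on)
  also have "\<dots> \<le> ennreal (c powr q) * (\<Sum>\<^sub>\<infinity>i\<in>S. ennreal (norm (y i) powr q))"
    by (rule infsum_cmult_le_ennreal)
  finally have "lp_root q (\<Sum>\<^sub>\<infinity>i\<in>S. ennreal (norm (x i) powr q))
      \<le> lp_root q (ennreal (c powr q) * (\<Sum>\<^sub>\<infinity>i\<in>S. ennreal (norm (y i) powr q)))"
    by (rule lp_root_mono[OF q])
  then show ?thesis
    using q assms(2) by (simp add: lp_norm_eq_lp_root[OF False] q_def[symmetric] lp_root_scale)
qed

lemma lp_norm_reindex_le:
  assumes "1 \<le> p" "inj_on h J" "h ` J \<subseteq> S"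
  shows "lp_norm p J (\<lambda>i. x (h i)) \<le> lp_norm p S x"
proof (cases "p = \<infinity>")
  case True
  then show ?thesis using assms by (auto simp: lp_norm_def intro!: SUP_least SUP_upper)
next
  case False
  define q where "q = enn2real p"
  have q: "q > 0" using enn2real_ge_1[OF assms(1) False] by (simp add: q_def)
  have "(\<Sum>\<^sub>\<infinity>i\<in>J. ennreal (norm (x (h i)) powr q))
      = (\<Sum>\<^sub>\<infinity>k\<in>h ` J. ennreal (norm (x k) powr q))"
    using infsum_reindex[OF assms(2), of "\<lambda>k. ennreal (norm (x k) powr q)"] by (simp add: o_def)
  also have "\<dots> \<le> (\<Sum>\<^sub>\<infinity>k\<in>S. ennreal (norm (x k) powr q))"
    using assms(3) by (intro infsum_mono_neutral ennreal_family_summable_on) auto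
  finally show ?thesis
    using q by (simp add: lp_norm_eq_lp_root[OF False] q_def[symmetric] lp_root_mono)
qed

lemma powr_add_le_add_powr:
  fixes a b q :: real
  assumes "a \<ge> 0" "b \<ge> 0" "q \<ge> 1"
  shows "a powr q + b powr q \<le> (a + b) powr q"
proof -
  have split: "c powr q = c * c powr (q - 1)" if "c \<ge> 0" for c :: real
    using that powr_add[of c 1 "q - 1"] by simp
  have "a powr q + b powr q = a * a powr (q - 1) + b * b powr (q - 1)"
    using assms split by simp
  also have "\<dots> \<le> a * (a + b) powr (q - 1) + b * (a + b) powr (q - 1)"
    using assms by (intro add_mono mult_left_mono powr_mono2) auto
  also have "\<dots> = (a + b) powr q" using assms split[of "a + b"] by (simp add: algebra_simps)
  finally show ?thesis .
qed

text \<open>The triangle inequality for two coordinates, which is all that is needed to keep the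
  perturbed inputs inside the cone.\<close>

lemma lp_norm_two_point_le:
  assumes "1 \<le> p" "a \<noteq> b" "\<And>i. i \<in> S \<Longrightarrow> i \<noteq> a \<Longrightarrow> i \<noteq> b \<Longrightarrow> x i = 0"
  shows "lp_norm p S x \<le> ennreal (norm (x a) + norm (x b))"
proof (cases "p = \<infinity>")
  case True
  have "norm (x i) \<le> norm (x a) + norm (x b)" if "i \<in> S" for i
    using assms(3)[OF that] by (cases "i = a"; cases "i = b") auto
  then show ?thesis
    using True by (auto simp: lp_norm_def simp del: ennreal_plus intro!: SUP_least ennreal_leI)
next
  case False
  define q where "q = enn2real p"
  have q: "q \<ge> 1" using enn2real_ge_1[OF assms(1) False] by (simp add: q_def)
  have "(\<Sum>\<^sub>\<infinity>i\<in>S. ennreal (norm (x i) powr q)) \<le> (\<Sum>\<^sub>\<infinity>i\<in>{a, b}. ennreal (norm (x i) powr q))"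
    using assms(3) q by (intro infsum_mono_neutral ennreal_family_summable_on) auto
  also have "\<dots> = ennreal (norm (x a) powr q + norm (x b) powr q)"
    using assms(2) by simp
  also have "\<dots> \<le> ennreal ((norm (x a) + norm (x b)) powr q)"
    using q by (intro ennreal_leI powr_add_le_add_powr) auto
  finally have "lp_root q (\<Sum>\<^sub>\<infinity>i\<in>S. ennreal (norm (x i) powr q))
      \<le> lp_root q (ennreal ((norm (x a) + norm (x b)) powr q))"
    using q by (intro lp_root_mono) auto
  then show ?thesis
    using q by (simp add: lp_norm_eq_lp_root[OF False] q_def[symmetric] lp_root_powr)
qed


section \<open>Information used by an algorithm\<close>

lemma set_history_mono: "m \<le> n \<Longrightarrow> set (history ALG f \<epsilon> m) \<subseteq> set (history ALG f \<epsilon> n)"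
proof (induction n)
  case (Suc n)
  have "set (history ALG f \<epsilon> n) \<subseteq> set (history ALG f \<epsilon> (Suc n))"
    by (auto split: decision.split)
  then show ?case using Suc by (cases "m = Suc n") auto
qed simp

lemma history_cong:
  assumes "\<And>k. k \<in> fst ` set (history ALG f \<epsilon> n) \<Longrightarrow> f' k = f k"
  shows "history ALG f' \<epsilon> n = history ALG f \<epsilon> n"
  using assms
proof (induction n)
  case (Suc n)
  have "history ALG f' \<epsilon> n = history ALG f \<epsilon> n"
    using Suc.prems set_history_mono[of n "Suc n" ALG f \<epsilon>]
    by (intro Suc.IH) (meson image_mono le_SucI order_refl subsetD)
  then show ?case using Suc.prems by (auto split: decision.splits)
qed simp

text \<open>Agreement is required only on the indices looked at for the first input: as long as both
  observed lists coincide, the next index asked for is the same, so the second run can never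
  leave this set.\<close>

lemma final_history_cong:
  assumes halts: "halts ALG f \<epsilon>"
    and agree: "\<And>k. k \<in> used_indices ALG f \<epsilon> \<Longrightarrow> f' k = f k"
  shows "final_history ALG f' \<epsilon> = final_history ALG f \<epsilon>"
proof -
  define N where "N = (LEAST n. stops_at ALG f \<epsilon> n)"
  have same: "history ALG f' \<epsilon> n = history ALG f \<epsilon> n" if "n \<le> N" for n
    using agree set_history_mono[OF that, of ALG f \<epsilon>]
    by (intro history_cong) (auto simp: used_indices_def final_history_def N_def[symmetric])
  have stopN: "stops_at ALG f \<epsilon> N"
    using halts unfolding halts_def N_def by (rule LeastI_ex)
  have "(LEAST n. stops_at ALG f' \<epsilon> n) = N"
  proof (rule Least_equality)
    show "stops_at ALG f' \<epsilon> N" using stopN same by (simp add: stops_at_def)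
  next
    fix n assume n: "stops_at ALG f' \<epsilon> n"
    show "N \<le> n"
    proof (rule ccontr)
      assume "\<not> N \<le> n"
      then have "stops_at ALG f \<epsilon> n" using n same by (simp add: stops_at_def)
      then have "N \<le> n" unfolding N_def by (rule Least_le)
      with \<open>\<not> N \<le> n\<close> show False by simp
    qed
  qed
  then show ?thesis using same by (simp add: final_history_def N_def[symmetric])
qed

lemma finite_used_indices: "finite (used_indices ALG f \<epsilon>)"
  by (simp add: used_indices_def)

text \<open>The radius-of-information argument: inputs that look alike get the same output, and this
  output must be within \<open>\<epsilon>\<close> of all of them. Since every coefficient is dominated by the \<open>\<ell>\<^sup>p\<close> norm,
  it suffices to compare a single coefficient.\<close>

lemma indistinguishable_inputs_close:
  fixes ALG :: "('k, 'a::real_normed_field) algorithm"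
  assumes "ALG \<in> algorithms \<tau> K \<C>" "1 \<le> \<tau>" "\<epsilon> > 0" "k \<in> K"
    and "f \<in> \<C>" "g \<in> \<C>" "h \<in> \<C>"
    and "\<And>i. i \<in> used_indices ALG f \<epsilon> \<Longrightarrow> g i = f i"
    and "\<And>i. i \<in> used_indices ALG f \<epsilon> \<Longrightarrow> h i = f i"
  shows "norm (g k - h k) \<le> 2 * \<epsilon>"
proof -
  let ?r = "result ALG f \<epsilon>"
  have halts: "halts ALG f \<epsilon>" using assms by (simp add: algorithms_def)
  have same: "result ALG g \<epsilon> = ?r" "result ALG h \<epsilon> = ?r"
    using final_history_cong[OF halts assms(8)] final_history_cong[OF halts assms(9)]
    by (simp_all add: result_def)
  have close: "norm (x k - result ALG x \<epsilon> k) \<le> \<epsilon>" if "x \<in> \<C>" for x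
  proof -
    have "ennreal (norm (x k - result ALG x \<epsilon> k)) \<le> G_norm \<tau> K (\<lambda>k. SOL x k - result ALG x \<epsilon> k)"
      unfolding G_norm_def SOL_def by (rule norm_le_lp_norm[OF assms(2,4)])
    also have "\<dots> \<le> ennreal \<epsilon>" using assms(1,3) that by (simp add: algorithms_def)
    finally show ?thesis using assms(3) by simp
  qed
  have "norm (g k - h k) \<le> norm (g k - ?r k) + norm (h k - ?r k)"
    using norm_triangle_ineq4[of "g k - ?r k" "h k - ?r k"] by simp
  then show ?thesis using close[OF assms(6)] close[OF assms(7)] same by simp
qed


section \<open>Lower bounds for the complexity in fixed dimension\<close>

locale cone_problem =
  fixes p :: ennreal and A :: real and n\<^sub>1 :: nat
    and K :: "'k set" and w :: "'k \<Rightarrow> real" and e :: "nat \<Rightarrow> 'k"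
  assumes p: "1 \<le> p" and A: "A > 1" and n1: "n\<^sub>1 \<ge> 1"
    and enum: "bij_betw e {1..} K"
    and w_pos: "\<And>k. k \<in> K \<Longrightarrow> w k > 0"
    and w_decr: "\<And>i. i \<ge> 1 \<Longrightarrow> w (e (Suc i)) \<le> w (e i)"
begin

lemma e_in: "i \<ge> 1 \<Longrightarrow> e i \<in> K"
  using enum by (auto simp: bij_betw_def)

lemma e_eq_iff: "i \<ge> 1 \<Longrightarrow> j \<ge> 1 \<Longrightarrow> e i = e j \<longleftrightarrow> i = j"
  using enum by (auto simp: bij_betw_def inj_on_def)

lemma K_cases: "k \<in> K \<Longrightarrow> (\<And>i. i \<ge> 1 \<Longrightarrow> k = e i \<Longrightarrow> thesis) \<Longrightarrow> thesis"
  using enum by (auto simp: bij_betw_def)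

lemma we_pos: "i \<ge> 1 \<Longrightarrow> w (e i) > 0"
  by (simp add: e_in w_pos)

lemma we_antimono: "1 \<le> i \<Longrightarrow> i \<le> j \<Longrightarrow> w (e j) \<le> w (e i)"
proof (induction j)
  case (Suc j)
  then show ?case using w_decr[of j] by (cases "i = Suc j") auto
qed simp

text \<open>On the cone the full norm is at most \<open>A\<close> times this norm of the leading coefficients. It is
  the only data-dependent quantity that an algorithm needs in order to bound its error.\<close>

definition head_norm :: "('k \<Rightarrow> 'a::real_normed_field) \<Rightarrow> ennreal" where
  "head_norm f = lp_norm p {1..n\<^sub>1} (\<lambda>i. f (e i) /\<^sub>R w (e i))"

abbreviation C :: "('k \<Rightarrow> 'a::real_normed_field) set" where
  "C \<equiv> cone p A n\<^sub>1 K w e"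

lemma in_C_iff:
  "f \<in> C \<longleftrightarrow> (\<forall>k. k \<notin> K \<longrightarrow> f k = 0) \<and> F_norm p K w f < \<infinity>
     \<and> F_norm p K w f \<le> ennreal A * head_norm f"
  by (auto simp: cone_def F_space_def coeff_families_def head_norm_def)

lemma head_norm_le_F_norm: "head_norm f \<le> F_norm p K w f"
  unfolding head_norm_def F_norm_def
  using lp_norm_reindex_le[OF p, of e "{1..n\<^sub>1}" K "\<lambda>k. f k /\<^sub>R w k"] e_in e_eq_iff
  by (auto simp: inj_on_def image_subset_iff)

text \<open>The parameters \<open>a\<close> and \<open>b\<close> are weighted coefficients, that is, coefficients divided by the
  weight: \<open>a\<close> sits at the largest weight, where it feeds the leading norm that defines the cone,
  and \<open>b\<close> at the \<open>j\<close>-th one.\<close>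

definition two_spikes :: "real \<Rightarrow> nat \<Rightarrow> real \<Rightarrow> 'k \<Rightarrow> 'a::real_normed_field" where
  "two_spikes a j b k = of_real (if k = e 1 then a * w (e 1) else if k = e j then b * w (e j) else 0)"

text \<open>The second spike may use up the slack \<open>(A - 1) a\<close> between the norm \<open>a\<close> of the leading
  coefficients and the norm \<open>A a\<close> that the cone condition then permits.\<close>

lemma two_spikes_in_cone:
  assumes "j > 1" "a \<ge> 0" "\<bar>b\<bar> \<le> (A - 1) * a"
  shows "F_norm p K w (two_spikes a j b :: 'k \<Rightarrow> 'a::real_normed_field) \<le> ennreal (A * a)"
    and "(two_spikes a j b :: 'k \<Rightarrow> 'a) \<in> C"
proof -
  let ?f = "two_spikes a j b :: 'k \<Rightarrow> 'a"
  have ne: "e 1 \<noteq> e j" using assms(1) by (simp add: e_eq_iff)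
  have v1: "norm (?f (e 1) /\<^sub>R w (e 1)) = a"
    using assms(2) we_pos[of 1] by (simp add: two_spikes_def norm_mult)
  have vj: "norm (?f (e j) /\<^sub>R w (e j)) = \<bar>b\<bar>"
    using assms(1) we_pos[of j] ne by (simp add: two_spikes_def norm_mult)
  have "F_norm p K w ?f \<le> ennreal (norm (?f (e 1) /\<^sub>R w (e 1)) + norm (?f (e j) /\<^sub>R w (e j)))"
    unfolding F_norm_def using ne by (intro lp_norm_two_point_le p) (auto simp: two_spikes_def)
  also have "\<dots> \<le> ennreal (A * a)"
    unfolding v1 vj using assms(3) by (intro ennreal_leI) (simp add: algebra_simps)
  finally show F: "F_norm p K w ?f \<le> ennreal (A * a)" .
  have "ennreal a \<le> head_norm ?f"
    unfolding head_norm_def using n1 v1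
      norm_le_lp_norm[OF p, of 1 "{1..n\<^sub>1}" "\<lambda>i. ?f (e i) /\<^sub>R w (e i)"] by simp
  then have "ennreal (A * a) \<le> ennreal A * head_norm ?f"
    using A assms(2) by (simp add: ennreal_mult mult_left_mono)
  moreover have "?f k = 0" if "k \<notin> K" for k
    using that e_in[of 1] e_in[of j] assms(1) by (auto simp: two_spikes_def)
  ultimately show "?f \<in> C"
    using F by (auto simp: in_C_iff intro: order.trans order.strict_trans1)
qed

text \<open>An algorithm that skips the \<open>j\<close>-th index on the single spike of size \<open>R / A\<close> cannot notice
  perturbations \<open>\<plusminus>b\<close> there. The choice \<open>b = (A - 1) (R / A)\<close> keeps the inputs in the cone and in
  the ball of radius \<open>R\<close>, and the resulting coefficients differ by more than \<open>2 \<epsilon>\<close>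
  exactly when the weight exceeds the stated threshold. The bound \<open>j > n\<^sub>1\<close> keeps the perturbed
  coefficient apart from the first one.\<close>

lemma used_indices_large:
  fixes ALG :: "('k, 'a::real_normed_field) algorithm"
  assumes ALG: "ALG \<in> algorithms p K C" and "\<epsilon> > 0" "R > 0" "j > n\<^sub>1"
    and large: "w (e j) > A / (A - 1) * \<epsilon> / R"
  shows "e j \<in> used_indices ALG (two_spikes (R / A) j 0) \<epsilon>"
proof (rule ccontr)
  let ?t = "\<lambda>b. two_spikes (R / A) j b :: 'k \<Rightarrow> 'a"
  define b where "b = (A - 1) * (R / A)"
  have j: "j > 1" using assms n1 by simp
  have b: "b > 0" using A assms by (simp add: b_def)
  assume unseen: "e j \<notin> used_indices ALG (?t 0) \<epsilon>"
  have C: "?t b \<in> C" "?t (- b) \<in> C" "?t 0 \<in> C"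
    using A assms b by (auto intro!: two_spikes_in_cone j simp: b_def)
  have agree: "?t c i = ?t 0 i" if "i \<in> used_indices ALG (?t 0) \<epsilon>" for i c
    using that unseen by (auto simp: two_spikes_def)
  have "e j \<in> K" using j by (simp add: e_in)
  then have "norm (?t b (e j) - ?t (- b) (e j)) \<le> 2 * \<epsilon>"
    by (rule indistinguishable_inputs_close[OF ALG p assms(2) _ C(3) C(1,2) agree agree])
  moreover have "?t b (e j) - ?t (- b) (e j) = of_real (2 * b * w (e j))"
    using j e_eq_iff[of j 1] by (simp add: two_spikes_def)
  ultimately have "b * w (e j) \<le> \<epsilon>"
    using b we_pos[of j] j by (simp add: norm_mult)
  moreover have "b * w (e j) > \<epsilon>"
  proof -
    have "\<epsilon> = b * (A / (A - 1) * \<epsilon> / R)" using A \<open>R > 0\<close> by (simp add: b_def)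
    also have "\<dots> < b * w (e j)" using large b by (rule mult_strict_left_mono)
    finally show ?thesis .
  qed
  ultimately show False by simp
qed

text \<open>Weights decrease, so all indices in \<open>{n\<^sub>1<..j}\<close> have large weights and must be looked at for
  one and the same input: a spike at the first index, with the second spike absent.\<close>

theorem COMP_lower_bound:
  assumes "\<epsilon> > 0" "R > 0" "j \<ge> 1"
    and large: "w (e j) > A / (A - 1) * \<epsilon> / R"
  shows "enat j \<le> COMP TYPE('a::real_normed_field) p p A n\<^sub>1 K w e \<epsilon> R + enat n\<^sub>1"
proof -
  let ?f = "two_spikes (R / A) (Suc n\<^sub>1) 0 :: 'k \<Rightarrow> 'a"
  have f_eq: "two_spikes (R / A) i 0 = ?f" for i
    by (simp add: two_spikes_def fun_eq_iff)
  have "A * (R / A) = R" using A by simp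
  then have f: "?f \<in> C" "F_norm p K w ?f \<le> ennreal R"
    using two_spikes_in_cone[of "Suc n\<^sub>1" "R / A" 0] A n1 assms(2) by auto
  have "enat (j - n\<^sub>1) \<le> (SUP f\<in>{f \<in> C. F_norm p K w f \<le> ennreal R}. enat (COST ALG f \<epsilon>))"
    if ALG: "ALG \<in> algorithms p K (C :: ('k \<Rightarrow> 'a) set)" for ALG
  proof -
    have "e i \<in> used_indices ALG ?f \<epsilon>" if i: "i \<in> {n\<^sub>1<..j}" for i
    proof -
      have "w (e i) > A / (A - 1) * \<epsilon> / R"
        using i n1 we_antimono[of i j] large by auto
      with i show ?thesis using used_indices_large[OF ALG assms(1,2), of i] f_eq[of i] by simp
    qed
    then have "card (e ` {n\<^sub>1<..j}) \<le> card (used_indices ALG ?f \<epsilon>)"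
      by (intro card_mono finite_used_indices) auto
    moreover have "card (e ` {n\<^sub>1<..j}) = j - n\<^sub>1"
      using e_eq_iff by (subst card_image) (auto simp: inj_on_def)
    ultimately have "enat (j - n\<^sub>1) \<le> enat (COST ALG ?f \<epsilon>)" by (simp add: COST_def)
    also have "\<dots> \<le> (SUP f\<in>{f \<in> C. F_norm p K w f \<le> ennreal R}. enat (COST ALG f \<epsilon>))"
      using f by (intro SUP_upper) auto
    finally show ?thesis .
  qed
  then have "enat (j - n\<^sub>1) \<le> COMP TYPE('a) p p A n\<^sub>1 K w e \<epsilon> R"
    unfolding COMP_def Let_def by (intro INF_greatest)
  then have "enat (j - n\<^sub>1) + enat n\<^sub>1 \<le> COMP TYPE('a) p p A n\<^sub>1 K w e \<epsilon> R + enat n\<^sub>1"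
    by (rule add_right_mono)
  moreover have "enat j \<le> enat (j - n\<^sub>1) + enat n\<^sub>1" by simp
  ultimately show ?thesis by (rule order_trans[rotated])
qed

text \<open>The cone contains arbitrarily large multiples of the first basis element, so no fixed output
  serves all of them. This lower bound makes the logarithm of the complexity non-negative, without
  which the limit in the definition of weak tractability could not be zero.\<close>

theorem COMP_ge_1:
  assumes "\<epsilon> > 0" "R > 0"
  shows "COMP TYPE('a::real_normed_field) p p A n\<^sub>1 K w e \<epsilon> R \<ge> 1"
proof -
  let ?t = "\<lambda>a. two_spikes a 2 0 :: 'k \<Rightarrow> 'a"
  have zero: "?t 0 \<in> C" "F_norm p K w (?t 0) \<le> ennreal R"
    using two_spikes_in_cone[of 2 0 0, where 'a = 'a] A by auto
  have e1: "e 1 \<in> K" by (simp add: e_in)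
  have "1 \<le> (SUP f\<in>{f \<in> C. F_norm p K w f \<le> ennreal R}. enat (COST ALG f \<epsilon>))"
    if ALG: "ALG \<in> algorithms p K (C :: ('k \<Rightarrow> 'a) set)" for ALG
  proof -
    have "used_indices ALG (?t 0) \<epsilon> \<noteq> {}"
    proof
      assume blind: "used_indices ALG (?t 0) \<epsilon> = {}"
      \<comment> \<open>Any coefficient larger than \<open>2 \<epsilon>\<close> would do.\<close>
      define a where "a = 3 * \<epsilon> / w (e 1)"
      have a: "a \<ge> 0" using assms we_pos[of 1] by (simp add: a_def)
      then have "?t a \<in> C" using A by (intro two_spikes_in_cone) auto
      then have "norm (?t a (e 1) - ?t 0 (e 1)) \<le> 2 * \<epsilon>"
        using blind
        by (intro indistinguishable_inputs_close[OF ALG p assms(1) e1 zero(1) _ zero(1)]) auto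
      then have "norm (of_real (a * w (e 1)) :: 'a) \<le> 2 * \<epsilon>" by (simp add: two_spikes_def)
      then have "\<bar>a * w (e 1)\<bar> \<le> 2 * \<epsilon>" by (simp only: norm_of_real)
      then show False using assms we_pos[of 1] by (simp add: a_def)
    qed
    then have "0 < COST ALG (?t 0) \<epsilon>" by (simp add: COST_def card_gt_0_iff finite_used_indices)
    then have "1 \<le> enat (COST ALG (?t 0) \<epsilon>)" by (simp add: one_enat_def)
    also have "\<dots> \<le> (SUP f\<in>{f \<in> C. F_norm p K w f \<le> ennreal R}. enat (COST ALG f \<epsilon>))"
      using zero by (intro SUP_upper) auto
    finally show ?thesis .
  qed
  then show ?thesis unfolding COMP_def Let_def by (intro INF_greatest)
qed

section \<open>An adaptive algorithm\<close>

definition observed :: "('k \<times> 'a::real_normed_field) list \<Rightarrow> 'k \<Rightarrow> 'a" where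
  "observed h k = (case map_of h k of Some v \<Rightarrow> v | None \<Rightarrow> 0)"

definition initial_part :: "('k \<Rightarrow> 'a::real_normed_field) \<Rightarrow> nat \<Rightarrow> 'k \<Rightarrow> 'a" where
  "initial_part f n k = (if k \<in> e ` {1..n} then f k else 0)"

definition initial_data :: "('k \<Rightarrow> 'a) \<Rightarrow> nat \<Rightarrow> ('k \<times> 'a) list" where
  "initial_data f n = map (\<lambda>i. (e i, f (e i))) [1..<Suc n]"

text \<open>The stopping rule: weight of the first index not yet seen, times the bound \<open>A N\<close> for the norm
  of the input, where \<open>N\<close> is the norm of its \<open>n\<^sub>1\<close> leading coefficients. The rule makes sense only
  after these have been observed.\<close>

definition accurate :: "real \<Rightarrow> ennreal \<Rightarrow> nat \<Rightarrow> bool" where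
  "accurate \<epsilon> N n \<longleftrightarrow> n\<^sub>1 \<le> n \<and> ennreal (w (e (Suc n))) * (ennreal A * N) \<le> ennreal \<epsilon>"

text \<open>Only the stopping time adapts to the input; the indices are visited in the order of decreasing
  weights, so the next one is determined by the number of coefficients already seen.\<close>

definition cone_alg :: "('k, 'a::real_normed_field) algorithm" where
  "cone_alg \<epsilon> h =
     (if accurate \<epsilon> (head_norm (observed h)) (length h)
      then Output (observed h) else Query (e (Suc (length h))))"

lemma length_initial_data [simp]: "length (initial_data f n) = n"
  by (simp add: initial_data_def)

lemma fst_set_initial_data: "fst ` set (initial_data f n) = e ` {1..n}"
  by (simp add: initial_data_def image_image atLeastLessThanSuc_atLeastAtMost del: upt_Suc)

lemma observed_initial_data: "observed (initial_data f n) = initial_part f n"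
proof
  fix k
  have "map_of (initial_data f n) = map_of (map (\<lambda>k. (k, f k)) (map e [1..<Suc n]))"
    by (simp add: initial_data_def o_def)
  also have "\<dots> = (Some \<circ> f) |` (e ` {1..n})"
    by (subst map_of_map_restrict) (simp add: atLeastLessThanSuc_atLeastAtMost del: upt_Suc)
  finally show "observed (initial_data f n) k = initial_part f n k"
    by (simp add: observed_def initial_part_def restrict_map_def)
qed

text \<open>Once \<open>n\<^sub>1\<close> coefficients are known, the stopping rule evaluated on the observed data agrees with
  the rule evaluated on the unknown input.\<close>

lemma head_norm_initial_part: "n\<^sub>1 \<le> n \<Longrightarrow> head_norm (initial_part f n) = head_norm f"
proof -
  assume "n\<^sub>1 \<le> n"
  then have "initial_part f n (e i) = f (e i)" if "i \<in> {1..n\<^sub>1}" for i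
    using that by (auto simp: initial_part_def)
  then show ?thesis
    unfolding head_norm_def by (intro lp_norm_cong) simp
qed

lemma cone_alg_initial_data:
  "cone_alg \<epsilon> (initial_data f n) =
     (if accurate \<epsilon> (head_norm f) n then Output (initial_part f n) else Query (e (Suc n)))"
  by (auto simp: cone_alg_def observed_initial_data accurate_def head_norm_initial_part)

lemma history_cone_alg:
  assumes "\<And>m. m < n \<Longrightarrow> \<not> accurate \<epsilon> (head_norm f) m"
  shows "history cone_alg f \<epsilon> n = initial_data f n"
  using assms
proof (induction n)
  case (Suc n)
  then have "history cone_alg f \<epsilon> n = initial_data f n" "\<not> accurate \<epsilon> (head_norm f) n" by auto
  then show ?case by (simp add: cone_alg_initial_data) (simp add: initial_data_def)
qed (simp add: initial_data_def)

lemma cone_alg_run: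
  assumes "accurate \<epsilon> (head_norm f) m"
  obtains n where "n \<le> m" "accurate \<epsilon> (head_norm f) n" "halts cone_alg f \<epsilon>"
    "used_indices cone_alg f \<epsilon> = e ` {1..n}" "result cone_alg f \<epsilon> = initial_part f n"
proof -
  define n where "n = (LEAST n. accurate \<epsilon> (head_norm f) n)"
  have n: "accurate \<epsilon> (head_norm f) n" "n \<le> m"
    unfolding n_def using assms by (auto intro: LeastI Least_le)
  have before: "\<not> accurate \<epsilon> (head_norm f) i" if "i < n" for i
    using that unfolding n_def by (rule not_less_Least)
  have hist: "history cone_alg f \<epsilon> i = initial_data f i" if "i \<le> n" for i
    using that before by (intro history_cone_alg) auto
  have stops: "stops_at cone_alg f \<epsilon> i \<longleftrightarrow> accurate \<epsilon> (head_norm f) i" if "i \<le> n" for i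
    using hist[OF that] by (simp add: stops_at_def cone_alg_initial_data)
  have "(LEAST i. stops_at cone_alg f \<epsilon> i) = n"
    using n stops before by (intro Least_equality) (auto simp: not_less[symmetric])
  then have final: "final_history cone_alg f \<epsilon> = initial_data f n"
    by (simp add: final_history_def hist)
  have "halts cone_alg f \<epsilon>" using n stops by (auto simp: halts_def)
  moreover have "used_indices cone_alg f \<epsilon> = e ` {1..n}"
    by (simp only: used_indices_def final fst_set_initial_data)
  moreover have "result cone_alg f \<epsilon> = initial_part f n"
    using n by (simp add: result_def final cone_alg_initial_data)
  ultimately show ?thesis using that n by blast
qed

text \<open>Here equality of the exponents of the two norms enters: coefficients beyond the \<open>n\<close>-th are
  weighted coefficients times weights of at most \<open>w (e (Suc n))\<close>, so the same \<open>\<ell>\<^sup>p\<close> norm appears on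
  both sides.\<close>

lemma tail_error:
  assumes "\<And>k. k \<notin> K \<Longrightarrow> f k = 0"
  shows "lp_norm p K (\<lambda>k. f k - initial_part f n k) \<le> ennreal (w (e (Suc n))) * F_norm p K w f"
  unfolding F_norm_def
proof (rule lp_norm_scale_mono[OF p we_pos])
  fix k assume "k \<in> K"
  then obtain i where i: "i \<ge> 1" "k = e i" by (rule K_cases)
  show "norm (f k - initial_part f n k) \<le> w (e (Suc n)) * norm (f k /\<^sub>R w k)"
  proof (cases "i \<le> n")
    case True
    then show ?thesis using i we_pos[of "Suc n"] by (auto simp: initial_part_def)
  next
    case False
    then have "w k \<le> w (e (Suc n))" using i we_antimono[of "Suc n" i] by simp
    moreover have "initial_part f n k = 0"
      using False i e_eq_iff by (auto simp: initial_part_def)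
    moreover have "norm (f k) = w k * norm (f k /\<^sub>R w k)" using w_pos[OF \<open>k \<in> K\<close>] by simp
    ultimately show ?thesis by (metis diff_zero mult_right_mono norm_ge_zero)
  qed
qed simp

lemma G_norm_initial_part_finite:
  assumes "F_norm p K w f < \<infinity>"
  shows "G_norm p K (initial_part f n) < \<infinity>"
proof -
  have "G_norm p K (initial_part f n) \<le> ennreal (w (e 1)) * F_norm p K w f"
    unfolding G_norm_def F_norm_def
  proof (rule lp_norm_scale_mono[OF p we_pos])
    fix k assume k: "k \<in> K"
    then obtain i where "i \<ge> 1" "k = e i" by (rule K_cases)
    then have "w k \<le> w (e 1)" using we_antimono[of 1 i] by simp
    then have "w k * norm (f k /\<^sub>R w k) \<le> w (e 1) * norm (f k /\<^sub>R w k)"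
      by (intro mult_right_mono) auto
    moreover have "norm (f k) = w k * norm (f k /\<^sub>R w k)" using w_pos[OF k] by simp
    moreover have "norm (initial_part f n k) \<le> norm (f k)" by (simp add: initial_part_def)
    ultimately show "norm (initial_part f n k) \<le> w (e 1) * norm (f k /\<^sub>R w k)" by linarith
  qed simp
  also have "\<dots> < \<infinity>" using assms by (simp add: ennreal_mult_less_top)
  finally show ?thesis .
qed

text \<open>The hypothesis is what makes the algorithm halt: if the weights did not tend to zero, the
  stopping rule might never be satisfied.\<close>

lemma cone_alg_in_algorithms:
  assumes vanish: "\<And>t. t > 0 \<Longrightarrow> \<exists>n. w (e (Suc n)) \<le> t"
  shows "cone_alg \<in> algorithms p K (C :: ('k \<Rightarrow> 'a::real_normed_field) set)"
proof -
  have "halts cone_alg f \<epsilon> \<and> used_indices cone_alg f \<epsilon> \<subseteq> K \<and> result cone_alg f \<epsilon> \<in> G_space p K \<and>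
      G_norm p K (\<lambda>k. SOL f k - result cone_alg f \<epsilon> k) \<le> ennreal \<epsilon>"
    if eps: "\<epsilon> > 0" and f: "f \<in> C" for \<epsilon> and f :: "'k \<Rightarrow> 'a"
  proof -
    have f': "F_norm p K w f < \<infinity>" "F_norm p K w f \<le> ennreal A * head_norm f"
      and supp: "\<And>k. k \<notin> K \<Longrightarrow> f k = 0"
      using f by (auto simp: in_C_iff)
    have "head_norm f < top" using head_norm_le_F_norm[of f] f'(1) by (auto intro: order.strict_trans1)
    then obtain r where r: "head_norm f = ennreal r" "r \<ge> 0" by (cases "head_norm f") auto
    \<comment> \<open>The summand 1 covers inputs whose leading coefficients all vanish.\<close>
    obtain m where "w (e (Suc m)) \<le> \<epsilon> / (A * r + 1)"
      using vanish[of "\<epsilon> / (A * r + 1)"] eps A r by (auto simp: add_nonneg_pos)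
    then have "w (e (Suc (max n\<^sub>1 m))) \<le> \<epsilon> / (A * r + 1)"
      using we_antimono[of "Suc m" "Suc (max n\<^sub>1 m)"] by simp
    then have "w (e (Suc (max n\<^sub>1 m))) * (A * r + 1) \<le> \<epsilon>"
      using A r by (subst (asm) pos_le_divide_eq) (auto simp: add_nonneg_pos)
    then have "w (e (Suc (max n\<^sub>1 m))) * (A * r) \<le> \<epsilon>"
      using we_pos[of "Suc (max n\<^sub>1 m)"] by (simp add: algebra_simps)
    then have "accurate \<epsilon> (head_norm f) (max n\<^sub>1 m)"
      using A r we_pos[of "Suc (max n\<^sub>1 m)"]
      by (simp add: accurate_def ennreal_mult[symmetric] ennreal_leI del: max.absorb1)
    then obtain n where n: "accurate \<epsilon> (head_norm f) n" "halts cone_alg f \<epsilon>"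
      "used_indices cone_alg f \<epsilon> = e ` {1..n}" "result cone_alg f \<epsilon> = initial_part f n"
      by (rule cone_alg_run)
    have "G_norm p K (\<lambda>k. SOL f k - result cone_alg f \<epsilon> k) \<le> ennreal (w (e (Suc n))) * F_norm p K w f"
      unfolding G_norm_def SOL_def n(4) by (rule tail_error[OF supp])
    also have "\<dots> \<le> ennreal (w (e (Suc n))) * (ennreal A * head_norm f)"
      using f' by (intro mult_left_mono) auto
    also have "\<dots> \<le> ennreal \<epsilon>" using n(1) by (simp add: accurate_def)
    finally have "G_norm p K (\<lambda>k. SOL f k - result cone_alg f \<epsilon> k) \<le> ennreal \<epsilon>" .
    moreover have "result cone_alg f \<epsilon> \<in> G_space p K"
      using G_norm_initial_part_finite[OF f'(1), of n] n(4) supp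
      by (simp add: G_space_def coeff_families_def initial_part_def)
    moreover have "used_indices cone_alg f \<epsilon> \<subseteq> K" using n(3) e_in by auto
    ultimately show ?thesis using n(2) by blast
  qed
  then show ?thesis by (simp add: algorithms_def)
qed

text \<open>The algorithm does not know \<open>R\<close>, but the leading norm of an input in the ball of radius \<open>R\<close> is
  at most \<open>R\<close>, so its stopping rule fires as soon as the rule with \<open>R\<close> in place of that norm would.\<close>

theorem COMP_upper_bound:
  assumes "\<And>t. t > 0 \<Longrightarrow> \<exists>n. w (e (Suc n)) \<le> t"
    and "\<epsilon> > 0" "R > 0" and small: "w (e (Suc m)) \<le> \<epsilon> / (A * R)"
  shows "COMP TYPE('a::real_normed_field) p p A n\<^sub>1 K w e \<epsilon> R \<le> enat (max n\<^sub>1 m)"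
proof -
  have "COST cone_alg f \<epsilon> \<le> max n\<^sub>1 m" if f: "F_norm p K w f \<le> ennreal R" for f :: "'k \<Rightarrow> 'a"
  proof -
    have "w (e (Suc (max n\<^sub>1 m))) \<le> \<epsilon> / (A * R)"
      using small we_antimono[of "Suc m" "Suc (max n\<^sub>1 m)"] by simp
    then have "w (e (Suc (max n\<^sub>1 m))) * (A * R) \<le> \<epsilon>"
      using A assms(3) by (subst (asm) pos_le_divide_eq) auto
    have "ennreal (w (e (Suc (max n\<^sub>1 m)))) * (ennreal A * head_norm f)
        \<le> ennreal (w (e (Suc (max n\<^sub>1 m)))) * (ennreal A * ennreal R)"
      using f head_norm_le_F_norm[of f] by (intro mult_left_mono) auto
    also have "\<dots> = ennreal (w (e (Suc (max n\<^sub>1 m))) * (A * R))"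
      using A assms(3) we_pos[of "Suc (max n\<^sub>1 m)"] by (simp add: ennreal_mult)
    also have "\<dots> \<le> ennreal \<epsilon>"
      by (rule ennreal_leI) fact
    finally have "accurate \<epsilon> (head_norm f) (max n\<^sub>1 m)" by (simp add: accurate_def)
    then obtain n where n: "n \<le> max n\<^sub>1 m" "used_indices cone_alg f \<epsilon> = e ` {1..n}"
      by (rule cone_alg_run)
    then show ?thesis using card_image_le[of "{1..n}" e] by (simp add: COST_def)
  qed
  then have "(SUP f\<in>{f \<in> (C :: ('k \<Rightarrow> 'a) set). F_norm p K w f \<le> ennreal R}. enat (COST cone_alg f \<epsilon>))
      \<le> enat (max n\<^sub>1 m)"
    by (intro SUP_least) auto
  then show ?thesis
    unfolding COMP_def Let_def by (intro INF_lower2[OF cone_alg_in_algorithms[OF assms(1)]])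
qed

end

section \<open>Counting, summation and logarithms\<close>

lemma SUP_ennreal_finite_iff:
  fixes f :: "'d \<Rightarrow> ennreal"
  shows "(SUP d\<in>D. f d) < \<infinity> \<longleftrightarrow> (\<exists>M\<ge>0. \<forall>d\<in>D. f d \<le> ennreal M)"
proof
  assume "(SUP d\<in>D. f d) < \<infinity>"
  then obtain M where "(SUP d\<in>D. f d) = ennreal M" "M \<ge> 0" by (cases "SUP d\<in>D. f d") auto
  then show "\<exists>M\<ge>0. \<forall>d\<in>D. f d \<le> ennreal M" by (metis SUP_upper)
next
  assume "\<exists>M\<ge>0. \<forall>d\<in>D. f d \<le> ennreal M"
  then obtain M where "\<forall>d\<in>D. f d \<le> ennreal M" by blast
  then have "(SUP d\<in>D. f d) \<le> ennreal M" by (intro SUP_least) auto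
  also have "\<dots> < \<infinity>" by simp
  finally show "(SUP d\<in>D. f d) < \<infinity>" .
qed

lemma ennreal_mult_le_iff_le_divide:
  assumes "c > 0" "M \<ge> 0"
  shows "ennreal c * s \<le> ennreal M \<longleftrightarrow> s \<le> ennreal (M / c)"
proof (cases s)
  case (real r)
  then show ?thesis using assms
    by (simp add: ennreal_mult[symmetric] pos_le_divide_eq mult.commute)
next
  case top
  then show ?thesis using assms by (simp add: ennreal_mult_top top_unique)
qed

lemma infsum_ennreal_le_suminf:
  fixes f g :: "nat \<Rightarrow> real"
  assumes "summable g" "\<And>i. g i \<ge> 0" "c \<ge> 0" "\<And>i. i \<in> S \<Longrightarrow> f i \<le> c * g i"
  shows "(\<Sum>\<^sub>\<infinity>i\<in>S. ennreal (f i)) \<le> ennreal (c * suminf g)"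
proof (rule infsum_le_finite_sums[OF ennreal_family_summable_on])
  fix F assume F: "finite F" "F \<subseteq> S"
  have "(\<Sum>i\<in>F. ennreal (f i)) \<le> (\<Sum>i\<in>F. ennreal (c * g i))"
    using F assms(4) by (intro sum_mono ennreal_leI) auto
  also have "\<dots> = ennreal (c * sum g F)"
    using assms(2,3) by (simp add: sum_distrib_left)
  also have "\<dots> \<le> ennreal (c * suminf g)"
    using assms F by (intro ennreal_leI mult_left_mono sum_le_suminf) auto
  finally show "(\<Sum>i\<in>F. ennreal (f i)) \<le> ennreal (c * suminf g)" .
qed

text \<open>Markov's inequality for a decreasing sequence. The \<open>i0\<close> extra terms pay for the part of the
  sequence that the sum does not see.\<close>

lemma count_le_of_sum_le:
  fixes u :: "nat \<Rightarrow> real" and g :: "real \<Rightarrow> real"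
  assumes decr: "\<And>i j. 1 \<le> i \<Longrightarrow> i \<le> j \<Longrightarrow> u j \<le> u i"
    and mono: "\<And>x. t < x \<Longrightarrow> g t \<le> g x" and "g t > 0"
    and sum: "(\<Sum>\<^sub>\<infinity>i\<in>{i0..}. ennreal (g (u i))) \<le> ennreal M" and "M \<ge> 0" "i0 \<ge> 1"
    and "u j > t"
  shows "real j \<le> real i0 + M / g t"
proof (cases "j < i0")
  case True
  then show ?thesis using assms by (simp add: add_increasing2)
next
  case False
  have "ennreal (real (card {i0..j}) * g t) = (\<Sum>i\<in>{i0..j}. ennreal (g t))"
    using assms by (simp add: ennreal_mult ennreal_of_nat_eq_real_of_nat)
  also have "\<dots> \<le> (\<Sum>i\<in>{i0..j}. ennreal (g (u i)))"
  proof (intro sum_mono ennreal_leI mono)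
    fix i assume "i \<in> {i0..j}"
    then have "u j \<le> u i" using \<open>i0 \<ge> 1\<close> by (intro decr) auto
    then show "t < u i" using \<open>u j > t\<close> by simp
  qed
  also have "\<dots> \<le> (\<Sum>\<^sub>\<infinity>i\<in>{i0..}. ennreal (g (u i)))" by (intro sum_le_infsum_ennreal) auto
  also have "\<dots> \<le> ennreal M" by (rule sum)
  finally have "real (card {i0..j}) * g t \<le> M" using assms by simp
  then have "real (card {i0..j}) \<le> M / g t" using assms by (simp add: pos_le_divide_eq)
  then show ?thesis using False by simp
qed

text \<open>Inverting a counting bound. The level \<open>T = 2 a / u i\<close> is chosen so that \<open>u i\<close> lies above
  \<open>a / T\<close>; the count then bounds \<open>i\<close> by a power of \<open>1 / u i\<close>.
  Indices beyond the count at the smallest admissible level \<open>T0\<close> are needed to make this \<open>T\<close>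
  admissible. The result is raised to the power \<open>s\<close>, with \<open>s > 1\<close> giving a summable bound.\<close>

lemma powr_decay_of_count:
  fixes u :: "nat \<Rightarrow> real"
  assumes "a > 0" "p > 0" "B > 0" "T0 > 0" "s > 0"
    and count: "\<And>T. T \<ge> T0 \<Longrightarrow> u i > a / T \<Longrightarrow> real i \<le> B * T powr p"
    and "u i > 0" "i \<ge> 1" and late: "real i > B * T0 powr p"
  shows "u i powr (p * s) \<le> (B * (2 * a) powr p) powr s * real i powr (- s)"
proof -
  have u2: "u i \<le> 2 * a / T0"
  proof (rule ccontr)
    assume "\<not> u i \<le> 2 * a / T0"
    moreover have "a / T0 \<le> 2 * a / T0" using assms by (intro divide_right_mono) auto
    ultimately have "real i \<le> B * T0 powr p" by (intro count) auto
    with late show False by simp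
  qed
  define T where "T = 2 * a / u i"
  have "T \<ge> T0" using u2 assms by (simp add: T_def field_simps)
  moreover have "a / T < u i" using assms by (simp add: T_def)
  ultimately have "real i \<le> B * T powr p" by (rule count)
  also have "\<dots> = B * (2 * a) powr p / u i powr p"
    using assms by (simp add: T_def powr_divide)
  finally have "u i powr p \<le> B * (2 * a) powr p / real i"
    using assms by (simp add: field_simps)
  then have "(u i powr p) powr s \<le> (B * (2 * a) powr p / real i) powr s"
    using assms by (intro powr_mono2) auto
  also have "\<dots> = (B * (2 * a) powr p) powr s * real i powr (- s)"
    using assms by (simp add: powr_divide powr_minus_divide)
  finally show ?thesis by (simp add: powr_powr)
qed

lemma powr_quotient: "R > 0 \<Longrightarrow> \<epsilon> > 0 \<Longrightarrow> R powr p * \<epsilon> powr (- p) = (R / \<epsilon>) powr (p::real)"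
  by (simp add: powr_divide powr_minus_divide)

lemma ln_enat_divide_less_iff:
  assumes "1 \<le> n" "y > 0"
  shows "ln_enat n / ereal y < ereal c \<longleftrightarrow> ereal_of_enat n < ereal (exp (c * y))"
proof (cases n)
  case (enat m)
  then have "m \<ge> 1" using assms(1) by (simp add: one_enat_def)
  then have "ln (real m) < c * y \<longleftrightarrow> real m < exp (c * y)"
    by (metis exp_less_cancel_iff exp_ln of_nat_0_less_iff less_le_trans zero_less_one)
  then show ?thesis
    using enat assms(2) \<open>m \<ge> 1\<close> by (simp add: ln_enat_def pos_divide_less_eq)
next
  case infinity
  then show ?thesis using assms(2) by (simp add: ln_enat_def)
qed

lemma ln_enat_divide_nonneg:
  assumes "1 \<le> n" "y > 0"
  shows "0 \<le> ln_enat n / ereal y"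
proof (cases n)
  case (enat m)
  then have "m \<ge> 1" using assms(1) by (simp add: one_enat_def)
  then show ?thesis using enat assms(2) by (simp add: ln_enat_def)
next
  case infinity
  then show ?thesis using assms(2) by (simp add: ln_enat_def)
qed

text \<open>For a complexity of at least 1 the quotient in the limit is non-negative, so only the upper
  estimate remains. Exponentiating it removes the logarithm and its infinite values.\<close>

lemma weakly_tractable_iff:
  assumes ge_1: "\<And>d \<epsilon> R. d \<ge> 1 \<Longrightarrow> \<epsilon> > 0 \<Longrightarrow> R > 0 \<Longrightarrow> 1 \<le> cpx d \<epsilon> R"
  shows "weakly_tractable cpx \<longleftrightarrow>
    (\<forall>c>0. \<exists>L. \<forall>d\<ge>1. \<forall>\<epsilon>>0. \<forall>R>0. real d + R / \<epsilon> \<ge> L \<longrightarrow>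
        ereal_of_enat (cpx d \<epsilon> R) < ereal (exp (c * (real d + R / \<epsilon>))))" (is "_ = ?rhs")
proof -
  let ?q = "\<lambda>d \<epsilon> R. ln_enat (cpx d \<epsilon> R) / ereal (real d + R / \<epsilon>)"
  let ?F = "inf (filtercomap (\<lambda>(d, \<epsilon>, R). real d + R / \<epsilon>) at_top)
    (principal {(d::nat, \<epsilon>::real, R::real). d \<ge> 1 \<and> \<epsilon> > 0 \<and> R > 0})"
  have ev: "(\<forall>\<^sub>F (d, \<epsilon>, R) in ?F. P d \<epsilon> R) \<longleftrightarrow>
      (\<exists>L. \<forall>d\<ge>1. \<forall>\<epsilon>>0. \<forall>R>0. real d + R / \<epsilon> \<ge> L \<longrightarrow> P d \<epsilon> R)" for P
    unfolding eventually_inf_principal eventually_filtercomap_at_top_linorder by (intro ex_cong1) auto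
  have y: "real d + R / \<epsilon> > 0" if "d \<ge> 1" "\<epsilon> > 0" "R > 0" for d and \<epsilon> R :: real
    using that by (intro add_pos_pos) auto
  have rhs: "?rhs \<longleftrightarrow> (\<forall>c>0. \<forall>\<^sub>F (d, \<epsilon>, R) in ?F. ?q d \<epsilon> R < ereal c)"
    unfolding ev using ln_enat_divide_less_iff[OF ge_1 y] by (auto simp: Let_def)
  have "weakly_tractable cpx \<longleftrightarrow> ((\<lambda>(d, \<epsilon>, R). ?q d \<epsilon> R) \<longlongrightarrow> 0) ?F"
    by (simp add: weakly_tractable_def)
  also have "\<dots> \<longleftrightarrow> (\<forall>c>0. \<forall>\<^sub>F (d, \<epsilon>, R) in ?F. ?q d \<epsilon> R < ereal c)"
  proof
    assume lim: "((\<lambda>(d, \<epsilon>, R). ?q d \<epsilon> R) \<longlongrightarrow> 0) ?F"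
    show "\<forall>c>0. \<forall>\<^sub>F (d, \<epsilon>, R) in ?F. ?q d \<epsilon> R < ereal c"
    proof (intro allI impI)
      fix c :: real assume "c > 0"
      then show "\<forall>\<^sub>F (d, \<epsilon>, R) in ?F. ?q d \<epsilon> R < ereal c"
        using order_tendstoD(2)[OF lim, of "ereal c"] by (simp add: case_prod_unfold)
    qed
  next
    assume small: "\<forall>c>0. \<forall>\<^sub>F (d, \<epsilon>, R) in ?F. ?q d \<epsilon> R < ereal c"
    show "((\<lambda>(d, \<epsilon>, R). ?q d \<epsilon> R) \<longlongrightarrow> 0) ?F"
    proof (rule order_tendstoI)
      fix b :: ereal assume "b < 0"
      then have "\<forall>\<^sub>F (d, \<epsilon>, R) in ?F. b < ?q d \<epsilon> R"
        unfolding ev using ln_enat_divide_nonneg[OF ge_1 y] by (blast intro: order.strict_trans2)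
      then show "\<forall>\<^sub>F z in ?F. b < (case z of (d, \<epsilon>, R) \<Rightarrow> ?q d \<epsilon> R)"
        by (simp add: case_prod_unfold)
    next
      fix b :: ereal assume "0 < b"
      then obtain c where c: "0 < ereal c" "ereal c < b" using ereal_dense2[of 0 b] by auto
      then have "\<forall>\<^sub>F (d, \<epsilon>, R) in ?F. ?q d \<epsilon> R < ereal c" using small by simp
      then have "\<forall>\<^sub>F (d, \<epsilon>, R) in ?F. ?q d \<epsilon> R < b"
        by (rule eventually_mono) (use c(2) in \<open>auto intro: order.strict_trans\<close>)
      then show "\<forall>\<^sub>F z in ?F. (case z of (d, \<epsilon>, R) \<Rightarrow> ?q d \<epsilon> R) < b"
        by (simp add: case_prod_unfold)
    qed
  qed
  finally show ?thesis using rhs by simp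
qed

section \<open>Tractability of sandwiched costs\<close>

text \<open>All that is needed of the complexity in order to decide tractability: up to constants that do
  not depend on the dimension, it is the number of weights above \<open>\<epsilon> / R\<close>.\<close>

locale cost_sandwich =
  fixes cpx :: "nat \<Rightarrow> real \<Rightarrow> real \<Rightarrow> enat" and l :: "nat \<Rightarrow> nat \<Rightarrow> real"
    and A :: real and n\<^sub>1 :: nat
  assumes A: "A > 1"
    and l_pos: "\<And>d i. d \<ge> 1 \<Longrightarrow> i \<ge> 1 \<Longrightarrow> l d i > 0"
    and l_antimono: "\<And>d i j. d \<ge> 1 \<Longrightarrow> 1 \<le> i \<Longrightarrow> i \<le> j \<Longrightarrow> l d j \<le> l d i"
    and cpx_ge_1: "\<And>d \<epsilon> R. d \<ge> 1 \<Longrightarrow> \<epsilon> > 0 \<Longrightarrow> R > 0 \<Longrightarrow> 1 \<le> cpx d \<epsilon> R"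
    and lower: "\<And>d \<epsilon> R j. d \<ge> 1 \<Longrightarrow> \<epsilon> > 0 \<Longrightarrow> R > 0 \<Longrightarrow> j \<ge> 1 \<Longrightarrow>
      l d j > A / (A - 1) * \<epsilon> / R \<Longrightarrow> enat j \<le> cpx d \<epsilon> R + enat n\<^sub>1"
    and upper: "\<And>d \<epsilon> R m. d \<ge> 1 \<Longrightarrow> (\<And>t. t > 0 \<Longrightarrow> \<exists>n. l d (Suc n) \<le> t) \<Longrightarrow> \<epsilon> > 0 \<Longrightarrow> R > 0 \<Longrightarrow>
      l d (Suc m) \<le> \<epsilon> / (A * R) \<Longrightarrow> cpx d \<epsilon> R \<le> enat (max n\<^sub>1 m)"
begin

lemma count_le_cost:
  assumes "d \<ge> 1" "\<epsilon> > 0" "R > 0" "ereal_of_enat (cpx d \<epsilon> R) \<le> ereal x"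
    and "j \<ge> 1" "l d j > A / (A - 1) / (R / \<epsilon>)"
  shows "real j \<le> x + real n\<^sub>1"
proof -
  have "l d j > A / (A - 1) * \<epsilon> / R" using assms(2,3,6) by simp
  then have j: "enat j \<le> cpx d \<epsilon> R + enat n\<^sub>1" using assms by (intro lower)
  from assms(4) obtain m where "cpx d \<epsilon> R = enat m" "real m \<le> x"
    by (cases "cpx d \<epsilon> R") auto
  with j show ?thesis by simp
qed

text \<open>Finiteness of the count at all levels expresses that the weights tend to zero. It has to be
  assumed separately, because without it there is no algorithm at all.\<close>

lemma cost_le_count:
  assumes "d \<ge> 1" "\<epsilon> > 0" "R > 0"
    and fin: "\<And>t. t > 0 \<Longrightarrow> \<exists>x. \<forall>j\<ge>1. l d j > t \<longrightarrow> real j \<le> x"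
    and count: "\<And>j. j \<ge> 1 \<Longrightarrow> l d j > \<epsilon> / (A * R) \<Longrightarrow> real j \<le> x" and "x \<ge> 0"
  shows "ereal_of_enat (cpx d \<epsilon> R) \<le> ereal (max (real n\<^sub>1) x)"
proof -
  have drop: "l d (Suc (nat \<lfloor>y\<rfloor>)) \<le> t" if "\<forall>j\<ge>1. l d j > t \<longrightarrow> real j \<le> y" for y t
  proof (rule ccontr)
    assume "\<not> ?thesis"
    then have "real (Suc (nat \<lfloor>y\<rfloor>)) \<le> y" using that by (simp add: not_le del: of_nat_Suc)
    then show False by linarith
  qed
  have "\<exists>n. l d (Suc n) \<le> t" if "t > 0" for t using fin[OF that] drop by blast
  then have "cpx d \<epsilon> R \<le> enat (max n\<^sub>1 (nat \<lfloor>x\<rfloor>))"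
    using assms(1-3) count by (intro upper drop) auto
  then have "ereal_of_enat (cpx d \<epsilon> R) \<le> ereal (real (max n\<^sub>1 (nat \<lfloor>x\<rfloor>)))"
    by (cases "cpx d \<epsilon> R") auto
  also have "real (max n\<^sub>1 (nat \<lfloor>x\<rfloor>)) \<le> max (real n\<^sub>1) x" using \<open>x \<ge> 0\<close> by linarith
  finally show ?thesis by simp
qed

lemma cost_le_of_sum:
  assumes "d \<ge> 1" "\<epsilon> > 0" "R > 0"
    and g: "\<And>t. t > 0 \<Longrightarrow> g t > 0" "\<And>t x. 0 < t \<Longrightarrow> t < x \<Longrightarrow> g t \<le> g x"
    and sum: "(\<Sum>\<^sub>\<infinity>i\<in>{i0..}. ennreal (g (l d i))) \<le> ennreal M" "M \<ge> 0" "i0 \<ge> 1"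
  shows "ereal_of_enat (cpx d \<epsilon> R) \<le> ereal (max (real n\<^sub>1) (real i0 + M / g (\<epsilon> / (A * R))))"
proof -
  have count: "real j \<le> real i0 + M / g t" if "t > 0" "l d j > t" for t j
    using that sum g l_antimono[OF assms(1)]
    by (intro count_le_of_sum_le[where u = "l d" and g = g]) auto
  have t: "\<epsilon> / (A * R) > 0" using A assms by simp
  show ?thesis
    using count t assms(1-3) g(1)[OF t] sum by (intro cost_le_count) auto
qed

lemma cost_le_powr:
  assumes "d \<ge> 1" "0 < \<epsilon>" "\<epsilon> \<le> 1" "R \<ge> 1" "\<eta> > 0"
    and sum: "(\<Sum>\<^sub>\<infinity>i\<in>{i0..}. ennreal (l d i powr \<eta>)) \<le> ennreal M" "M \<ge> 0" "i0 \<ge> 1"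
  shows "ereal_of_enat (cpx d \<epsilon> R)
    \<le> ereal ((real n\<^sub>1 + real i0 + M * A powr \<eta>) * (R powr \<eta> * \<epsilon> powr (- \<eta>)))"
proof -
  define P where "P = R powr \<eta> * \<epsilon> powr (- \<eta>)"
  have P: "P = (R / \<epsilon>) powr \<eta>" unfolding P_def using assms by (intro powr_quotient) auto
  then have "P \<ge> 1" using assms by (simp add: ge_one_powr_ge_zero)
  have "1 / (\<epsilon> / (A * R)) powr \<eta> = A powr \<eta> * P"
    using assms A by (simp add: P powr_divide powr_mult)
  then have eq: "M / (\<epsilon> / (A * R)) powr \<eta> = M * A powr \<eta> * P"
    by (metis divide_inverse inverse_eq_divide mult.assoc)
  have "ereal_of_enat (cpx d \<epsilon> R) \<le> ereal (max (real n\<^sub>1) (real i0 + M / (\<epsilon> / (A * R)) powr \<eta>))"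
    using assms by (intro cost_le_of_sum[where g = "\<lambda>t. t powr \<eta>"] powr_mono2) auto
  also have "\<dots> \<le> ereal (real n\<^sub>1 + real i0 + M * A powr \<eta> * P)"
    unfolding eq using \<open>M \<ge> 0\<close> \<open>P \<ge> 1\<close> by simp
  also have "\<dots> \<le> ereal ((real n\<^sub>1 + real i0 + M * A powr \<eta>) * P)"
  proof -
    have "(real n\<^sub>1 + real i0) * 1 \<le> (real n\<^sub>1 + real i0) * P"
      using \<open>P \<ge> 1\<close> by (intro mult_left_mono) auto
    then show ?thesis by (simp add: algebra_simps)
  qed
  finally show ?thesis by (simp add: P_def)
qed

text \<open>The factor \<open>\<delta>\<close> is 1 for strong polynomial tractability and a power of the dimension for
  polynomial tractability; the constants must not depend on it. The exponent \<open>p'\<close> lies strictly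
  between \<open>p\<close> and \<open>\<eta>\<close>: it is positive even for \<open>p = 0\<close>, and \<open>\<eta> / p' > 1\<close> makes the comparison series
  converge. The term \<open>n\<^sub>1\<close> of the lower bound and the change from \<open>p\<close> to \<open>p'\<close> are absorbed in the
  constant, since \<open>T\<close> stays above \<open>T0\<close>.\<close>

lemma powr_sum_le_of_cost_le:
  assumes "p \<ge> 0" "C \<ge> 0" "\<epsilon>max > 0" "Rmin > 0" "p < \<eta>"
  obtains B D \<sigma> where "B \<ge> 0" "D \<ge> 0" "\<sigma> \<ge> 0"
    "\<And>d \<delta> i0. d \<ge> 1 \<Longrightarrow> \<delta> \<ge> 1 \<Longrightarrow> real i0 > B * \<delta> \<Longrightarrow>
      (\<And>\<epsilon> R. 0 < \<epsilon> \<Longrightarrow> \<epsilon> \<le> \<epsilon>max \<Longrightarrow> Rmin \<le> R \<Longrightarrow>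
        ereal_of_enat (cpx d \<epsilon> R) \<le> ereal (C * \<delta> * R powr p * \<epsilon> powr (- p))) \<Longrightarrow>
      (\<Sum>\<^sub>\<infinity>i\<in>{i0..}. ennreal (l d i powr \<eta>)) \<le> ennreal (D * \<delta> powr \<sigma>)"
proof -
  define a where "a = A / (A - 1)"
  define T0 where "T0 = Rmin / \<epsilon>max"
  define p' where "p' = (p + \<eta>) / 2"
  define s where "s = \<eta> / p'"
  define b where "b = C * T0 powr (p - p') + real n\<^sub>1 * T0 powr (- p') + 1"
  define g where "g = (\<lambda>n. real n powr (- s))"
  have pos: "a > 0" "T0 > 0" "p' > 0" "p' \<ge> p" using A assms by (auto simp: a_def T0_def p'_def)
  have "s > 1" using assms pos by (simp add: s_def p'_def field_simps)
  have b: "b > 0" using assms by (simp add: b_def add_nonneg_pos)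
  have g: "summable g" unfolding g_def using \<open>s > 1\<close> by (subst summable_real_powr_iff) simp
  show ?thesis
  proof (rule that)
    show "0 \<le> b * T0 powr p'" using b by simp
    show "0 \<le> (b * (2 * a) powr p') powr s * suminf g"
      using g by (intro mult_nonneg_nonneg suminf_nonneg) (auto simp: g_def)
    show "0 \<le> s" using \<open>s > 1\<close> by simp
  next
    fix d i0 :: nat and \<delta> :: real
    assume d: "d \<ge> 1" and \<delta>: "\<delta> \<ge> 1" and i0: "real i0 > b * T0 powr p' * \<delta>"
      and cost: "\<And>\<epsilon> R. 0 < \<epsilon> \<Longrightarrow> \<epsilon> \<le> \<epsilon>max \<Longrightarrow> Rmin \<le> R \<Longrightarrow>
        ereal_of_enat (cpx d \<epsilon> R) \<le> ereal (C * \<delta> * R powr p * \<epsilon> powr (- p))"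
    have count: "real j \<le> b * \<delta> * T powr p'"
      if "j \<ge> 1" "T \<ge> T0" "l d j > a / T" for j T
    proof -
      have T: "T > 0" using that pos by simp
      have R: "Rmin \<le> T * \<epsilon>max" using that assms by (simp add: T0_def pos_divide_le_eq)
      have "(T * \<epsilon>max) powr p * \<epsilon>max powr (- p) = T powr p"
        using powr_quotient[of "T * \<epsilon>max" \<epsilon>max p] T assms by simp
      then have "C * \<delta> * (T * \<epsilon>max) powr p * \<epsilon>max powr (- p) = C * \<delta> * T powr p"
        by (simp only: mult.assoc)
      moreover have "ereal_of_enat (cpx d \<epsilon>max (T * \<epsilon>max))
          \<le> ereal (C * \<delta> * (T * \<epsilon>max) powr p * \<epsilon>max powr (- p))"
        using R assms by (intro cost) auto
      ultimately have "ereal_of_enat (cpx d \<epsilon>max (T * \<epsilon>max)) \<le> ereal (C * \<delta> * T powr p)"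
        by (simp only:)
      then have "real j \<le> C * \<delta> * T powr p + real n\<^sub>1"
        using d that T assms by (intro count_le_cost) (auto simp: a_def)
      also have "T powr p \<le> T0 powr (p - p') * T powr p'"
      proof -
        have "T powr p = T powr (p - p') * T powr p'" using T by (simp add: powr_add[symmetric])
        also have "\<dots> \<le> T0 powr (p - p') * T powr p'"
          using that pos by (intro mult_right_mono powr_mono2') auto
        finally show ?thesis .
      qed
      also have "real n\<^sub>1 \<le> real n\<^sub>1 * (T0 powr (- p') * \<delta> * T powr p')"
      proof -
        have "1 \<le> (T / T0) powr p'" using that pos by (intro ge_one_powr_ge_zero) auto
        also have "\<dots> = T0 powr (- p') * T powr p'"
          using T pos by (simp add: powr_divide powr_minus_divide mult.commute)
        also have "\<dots> \<le> T0 powr (- p') * T powr p' * \<delta>"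
          using mult_left_mono[OF \<delta>, of "T0 powr (- p') * T powr p'"] by simp
        finally have "1 \<le> T0 powr (- p') * \<delta> * T powr p'" by (simp add: mult_ac)
        then show ?thesis using mult_left_mono[of 1 _ "real n\<^sub>1"] by fastforce
      qed
      also have "C * \<delta> * (T0 powr (p - p') * T powr p') + real n\<^sub>1 * (T0 powr (- p') * \<delta> * T powr p')
          \<le> b * \<delta> * T powr p'"
        using \<delta> by (simp add: b_def algebra_simps)
      finally show ?thesis using assms \<delta> by (simp add: mult_left_mono)
    qed
    have decay: "l d i powr \<eta> \<le> ((b * (2 * a) powr p') powr s * \<delta> powr s) * g i" if "i \<in> {i0..}" for i
    proof -
      have i: "i \<ge> 1" "real i > b * \<delta> * T0 powr p'"
      proof -
        have "0 < b * T0 powr p' * \<delta>" using b pos \<delta> by simp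
        then show "i \<ge> 1" using that i0 by (cases i) auto
        show "real i > b * \<delta> * T0 powr p'" using that i0 by (simp add: mult_ac)
      qed
      have "l d i powr (p' * s) \<le> (b * \<delta> * (2 * a) powr p') powr s * real i powr (- s)"
        using i pos b \<delta> \<open>s > 1\<close> d l_pos count[OF i(1)]
        by (intro powr_decay_of_count[where ?T0.0 = T0]) auto
      also have "p' * s = \<eta>" using pos by (simp add: s_def)
      also have "(b * \<delta> * (2 * a) powr p') powr s = (b * (2 * a) powr p') powr s * \<delta> powr s"
        using b \<delta> by (simp add: powr_mult mult_ac)
      finally show ?thesis by (simp add: g_def)
    qed
    have "(\<Sum>\<^sub>\<infinity>i\<in>{i0..}. ennreal (l d i powr \<eta>))
        \<le> ennreal (((b * (2 * a) powr p') powr s * \<delta> powr s) * suminf g)"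
      using decay by (intro infsum_ennreal_le_suminf g) (auto simp: g_def)
    then show "(\<Sum>\<^sub>\<infinity>i\<in>{i0..}. ennreal (l d i powr \<eta>))
        \<le> ennreal ((b * (2 * a) powr p') powr s * suminf g * \<delta> powr s)"
      by (simp add: mult_ac)
  qed
qed

definition summability_exponents :: "real set" where
  "summability_exponents =
     {\<eta>. \<eta> > 0 \<and> (\<exists>i0\<ge>1. (SUP d\<in>{1..}. \<Sum>\<^sub>\<infinity>i\<in>{i0..}. ennreal (l d i powr \<eta>)) < \<infinity>)}"

text \<open>The next two lemmas say that the set of exponents admitted by the complexity and the set of
  summability exponents coincide, except that the former may contain its infimum when the latter
  does not. This gives both the criterion and the equality of the two infima.\<close>

lemma spt_with_summability_exponent:
  assumes "\<eta> \<in> summability_exponents"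
  shows "spt_with_exponent cpx \<eta>"
proof -
  from assms obtain i0 M where "\<eta> > 0" "i0 \<ge> 1" "M \<ge> 0"
    and M: "\<And>d. d \<ge> 1 \<Longrightarrow> (\<Sum>\<^sub>\<infinity>i\<in>{i0..}. ennreal (l d i powr \<eta>)) \<le> ennreal M"
    unfolding summability_exponents_def SUP_ennreal_finite_iff by auto
  define C where "C = real n\<^sub>1 + real i0 + M * A powr \<eta>"
  have "C \<ge> 0" using \<open>M \<ge> 0\<close> by (simp add: C_def)
  moreover have "ereal_of_enat (cpx d \<epsilon> R) \<le> ereal (C * R powr \<eta> * \<epsilon> powr (- \<eta>))"
    if "d \<ge> 1" "\<epsilon> \<in> {0<..1}" "R \<ge> 1" for d \<epsilon> R
    using cost_le_powr[of d \<epsilon> R \<eta> i0 M] that M \<open>\<eta> > 0\<close> \<open>i0 \<ge> 1\<close> \<open>M \<ge> 0\<close>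
    by (simp add: C_def mult.assoc)
  ultimately show ?thesis
    unfolding spt_with_exponent_def using \<open>\<eta> > 0\<close>
    by (intro conjI exI[of _ C] exI[of _ "1::real"]) auto
qed

lemma summability_exponent_of_spt:
  assumes "spt_with_exponent cpx p" "p < \<eta>"
  shows "\<eta> \<in> summability_exponents"
proof -
  from assms(1) obtain C \<epsilon>max Rmin where h: "p \<ge> 0" "C \<ge> 0" "\<epsilon>max > 0" "Rmin > 0"
    and cost: "\<And>d \<epsilon> R. d \<ge> 1 \<Longrightarrow> 0 < \<epsilon> \<Longrightarrow> \<epsilon> \<le> \<epsilon>max \<Longrightarrow> Rmin \<le> R \<Longrightarrow>
      ereal_of_enat (cpx d \<epsilon> R) \<le> ereal (C * R powr p * \<epsilon> powr (- p))"
    by (auto simp: spt_with_exponent_def)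
  obtain B D \<sigma> where BD: "B \<ge> 0" "D \<ge> 0" "\<sigma> \<ge> 0" and
    sum: "\<And>d \<delta> i0. d \<ge> 1 \<Longrightarrow> \<delta> \<ge> 1 \<Longrightarrow> real i0 > B * \<delta> \<Longrightarrow>
      (\<And>\<epsilon> R. 0 < \<epsilon> \<Longrightarrow> \<epsilon> \<le> \<epsilon>max \<Longrightarrow> Rmin \<le> R \<Longrightarrow>
        ereal_of_enat (cpx d \<epsilon> R) \<le> ereal (C * \<delta> * R powr p * \<epsilon> powr (- p))) \<Longrightarrow>
      (\<Sum>\<^sub>\<infinity>i\<in>{i0..}. ennreal (l d i powr \<eta>)) \<le> ennreal (D * \<delta> powr \<sigma>)"
    using powr_sum_le_of_cost_le[OF h assms(2)] by blast
  define i0 where "i0 = Suc (nat \<lceil>B\<rceil>)"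
  have i0: "real i0 > B * 1" unfolding i0_def by linarith
  have "(\<Sum>\<^sub>\<infinity>i\<in>{i0..}. ennreal (l d i powr \<eta>)) \<le> ennreal D" if "d \<ge> 1" for d
    using sum[OF that _ i0] cost[OF that] by simp
  then have "(SUP d\<in>{1..}. \<Sum>\<^sub>\<infinity>i\<in>{i0..}. ennreal (l d i powr \<eta>)) < \<infinity>"
    unfolding SUP_ennreal_finite_iff using BD by auto
  moreover have "i0 \<ge> 1" by (simp add: i0_def)
  ultimately show ?thesis using h assms by (auto simp: summability_exponents_def)
qed

theorem strongly_polynomially_tractable_iff:
  "strongly_polynomially_tractable cpx \<longleftrightarrow> summability_exponents \<noteq> {}"
proof
  assume "strongly_polynomially_tractable cpx"
  then obtain p where "spt_with_exponent cpx p" unfolding strongly_polynomially_tractable_def ..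
  then have "p + 1 \<in> summability_exponents" by (rule summability_exponent_of_spt) simp
  then show "summability_exponents \<noteq> {}" by blast
next
  assume "summability_exponents \<noteq> {}"
  then obtain \<eta> where "\<eta> \<in> summability_exponents" by blast
  then show "strongly_polynomially_tractable cpx"
    unfolding strongly_polynomially_tractable_def by (intro exI spt_with_summability_exponent)
qed

theorem spt_exponent_eq:
  assumes "strongly_polynomially_tractable cpx"
  shows "spt_exponent cpx = Inf summability_exponents"
proof (rule antisym)
  have ne: "summability_exponents \<noteq> {}" using assms by (simp add: strongly_polynomially_tractable_iff)
  have P: "bdd_below {p. spt_with_exponent cpx p}"
    by (rule bdd_belowI[of _ 0]) (auto simp: spt_with_exponent_def)
  then show "spt_exponent cpx \<le> Inf summability_exponents"
    unfolding spt_exponent_def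
    using ne spt_with_summability_exponent by (intro cInf_superset_mono) auto
  have E: "bdd_below summability_exponents"
    by (rule bdd_belowI[of _ 0]) (auto simp: summability_exponents_def)
  show "Inf summability_exponents \<le> spt_exponent cpx"
    unfolding spt_exponent_def
  proof (rule cInf_greatest)
    show "{p. spt_with_exponent cpx p} \<noteq> {}"
      using assms by (auto simp: strongly_polynomially_tractable_def)
    fix p assume "p \<in> {p. spt_with_exponent cpx p}"
    then have "Inf summability_exponents \<le> \<eta>" if "p < \<eta>" for \<eta>
      using summability_exponent_of_spt that E by (auto intro: cInf_lower)
    then show "Inf summability_exponents \<le> p" by (rule dense_ge)
  qed
qed

text \<open>A dimension-dependent constant \<open>d\<^sup>q\<close> in the cost delays the start of the sum by a multiple of
  \<open>d\<^sup>q\<close> and enlarges its value by a power of \<open>d\<close>, and conversely.\<close>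

theorem polynomially_tractable_iff:
  "polynomially_tractable cpx \<longleftrightarrow>
     (\<exists>\<eta>\<^sub>1 \<eta>\<^sub>2 \<eta>\<^sub>3 \<kappa> :: real. \<eta>\<^sub>1 \<ge> 0 \<and> \<eta>\<^sub>2 \<ge> 0 \<and> \<eta>\<^sub>3 > 0 \<and> \<kappa> > 0 \<and>
        (SUP d\<in>{1..}. ennreal (real d powr (- \<eta>\<^sub>1)) *
           (\<Sum>\<^sub>\<infinity>i\<in>{nat \<lceil>\<kappa> * real d powr \<eta>\<^sub>2\<rceil>..}. ennreal (l d i powr \<eta>\<^sub>3))) < \<infinity>)"
proof
  assume "polynomially_tractable cpx"
  then obtain C p q \<epsilon>max Rmin where h: "p \<ge> 0" "C \<ge> 0" "\<epsilon>max > 0" "Rmin > 0" and "q \<ge> 0"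
    and cost: "\<And>d \<epsilon> R. d \<ge> 1 \<Longrightarrow> 0 < \<epsilon> \<Longrightarrow> \<epsilon> \<le> \<epsilon>max \<Longrightarrow> Rmin \<le> R \<Longrightarrow>
      ereal_of_enat (cpx d \<epsilon> R) \<le> ereal (C * real d powr q * R powr p * \<epsilon> powr (- p))"
    by (auto simp: polynomially_tractable_def)
  obtain B D \<sigma> where BD: "B \<ge> 0" "D \<ge> 0" "\<sigma> \<ge> 0" and
    sum: "\<And>d \<delta> i0. d \<ge> 1 \<Longrightarrow> \<delta> \<ge> 1 \<Longrightarrow> real i0 > B * \<delta> \<Longrightarrow>
      (\<And>\<epsilon> R. 0 < \<epsilon> \<Longrightarrow> \<epsilon> \<le> \<epsilon>max \<Longrightarrow> Rmin \<le> R \<Longrightarrow>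
        ereal_of_enat (cpx d \<epsilon> R) \<le> ereal (C * \<delta> * R powr p * \<epsilon> powr (- p))) \<Longrightarrow>
      (\<Sum>\<^sub>\<infinity>i\<in>{i0..}. ennreal (l d i powr (p + 1))) \<le> ennreal (D * \<delta> powr \<sigma>)"
    using powr_sum_le_of_cost_le[OF h less_add_one] by blast
  have "ennreal (real d powr (- (q * \<sigma>))) *
      (\<Sum>\<^sub>\<infinity>i\<in>{nat \<lceil>(B + 1) * real d powr q\<rceil>..}. ennreal (l d i powr (p + 1))) \<le> ennreal D"
    if d: "d \<ge> 1" for d
  proof -
    have dq: "real d powr q \<ge> 1" using d \<open>q \<ge> 0\<close> by (simp add: ge_one_powr_ge_zero)
    have "B * real d powr q < (B + 1) * real d powr q" using d by simp
    also have "\<dots> \<le> real (nat \<lceil>(B + 1) * real d powr q\<rceil>)" by (rule real_nat_ceiling_ge)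
    finally have "(\<Sum>\<^sub>\<infinity>i\<in>{nat \<lceil>(B + 1) * real d powr q\<rceil>..}. ennreal (l d i powr (p + 1)))
        \<le> ennreal (D * (real d powr q) powr \<sigma>)"
      using cost d dq by (intro sum) auto
    also have "D * (real d powr q) powr \<sigma> = D / real d powr (- (q * \<sigma>))"
      by (simp add: powr_powr powr_minus divide_inverse)
    finally show ?thesis using d BD by (subst ennreal_mult_le_iff_le_divide) auto
  qed
  then have "(SUP d\<in>{1..}. ennreal (real d powr (- (q * \<sigma>))) *
      (\<Sum>\<^sub>\<infinity>i\<in>{nat \<lceil>(B + 1) * real d powr q\<rceil>..}. ennreal (l d i powr (p + 1)))) < \<infinity>"
    unfolding SUP_ennreal_finite_iff using BD by auto
  moreover have "q * \<sigma> \<ge> 0" "p + 1 > 0" "B + 1 > 0" using \<open>q \<ge> 0\<close> BD h by auto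
  ultimately show "\<exists>\<eta>\<^sub>1 \<eta>\<^sub>2 \<eta>\<^sub>3 \<kappa> :: real. \<eta>\<^sub>1 \<ge> 0 \<and> \<eta>\<^sub>2 \<ge> 0 \<and> \<eta>\<^sub>3 > 0 \<and> \<kappa> > 0 \<and>
      (SUP d\<in>{1..}. ennreal (real d powr (- \<eta>\<^sub>1)) *
         (\<Sum>\<^sub>\<infinity>i\<in>{nat \<lceil>\<kappa> * real d powr \<eta>\<^sub>2\<rceil>..}. ennreal (l d i powr \<eta>\<^sub>3))) < \<infinity>"
    using \<open>q \<ge> 0\<close> by blast
next
  assume "\<exists>\<eta>\<^sub>1 \<eta>\<^sub>2 \<eta>\<^sub>3 \<kappa> :: real. \<eta>\<^sub>1 \<ge> 0 \<and> \<eta>\<^sub>2 \<ge> 0 \<and> \<eta>\<^sub>3 > 0 \<and> \<kappa> > 0 \<and>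
      (SUP d\<in>{1..}. ennreal (real d powr (- \<eta>\<^sub>1)) *
         (\<Sum>\<^sub>\<infinity>i\<in>{nat \<lceil>\<kappa> * real d powr \<eta>\<^sub>2\<rceil>..}. ennreal (l d i powr \<eta>\<^sub>3))) < \<infinity>"
  then obtain \<eta>\<^sub>1 \<eta>\<^sub>2 \<eta>\<^sub>3 \<kappa> M :: real
    where h: "\<eta>\<^sub>1 \<ge> 0" "\<eta>\<^sub>2 \<ge> 0" "\<eta>\<^sub>3 > 0" "\<kappa> > 0" "M \<ge> 0"
    and M: "\<And>d. d \<ge> 1 \<Longrightarrow> ennreal (real d powr (- \<eta>\<^sub>1)) *
      (\<Sum>\<^sub>\<infinity>i\<in>{nat \<lceil>\<kappa> * real d powr \<eta>\<^sub>2\<rceil>..}. ennreal (l d i powr \<eta>\<^sub>3)) \<le> ennreal M"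
    unfolding SUP_ennreal_finite_iff by auto
  define C where "C = real n\<^sub>1 + \<kappa> + 1 + M * A powr \<eta>\<^sub>3"
  define q where "q = max \<eta>\<^sub>1 \<eta>\<^sub>2"
  have "ereal_of_enat (cpx d \<epsilon> R) \<le> ereal (C * real d powr q * R powr \<eta>\<^sub>3 * \<epsilon> powr (- \<eta>\<^sub>3))"
    if d: "d \<ge> 1" and eps: "\<epsilon> \<in> {0<..1}" and R: "R \<ge> 1" for d \<epsilon> R
  proof -
    define i0 where "i0 = nat \<lceil>\<kappa> * real d powr \<eta>\<^sub>2\<rceil>"
    have "\<kappa> * real d powr \<eta>\<^sub>2 > 0" using h d by simp
    then have i0: "i0 \<ge> 1" "real i0 \<le> \<kappa> * real d powr \<eta>\<^sub>2 + 1" unfolding i0_def by linarith+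
    have "(\<Sum>\<^sub>\<infinity>i\<in>{i0..}. ennreal (l d i powr \<eta>\<^sub>3)) \<le> ennreal (M / real d powr (- \<eta>\<^sub>1))"
      using M[OF d] d h unfolding i0_def by (subst (asm) ennreal_mult_le_iff_le_divide) auto
    also have "M / real d powr (- \<eta>\<^sub>1) = M * real d powr \<eta>\<^sub>1" by (simp add: powr_minus divide_inverse)
    finally have "ereal_of_enat (cpx d \<epsilon> R) \<le>
        ereal ((real n\<^sub>1 + real i0 + M * real d powr \<eta>\<^sub>1 * A powr \<eta>\<^sub>3) * (R powr \<eta>\<^sub>3 * \<epsilon> powr (- \<eta>\<^sub>3)))"
      using d eps R h i0 by (intro cost_le_powr) auto
    also have "\<dots> \<le> ereal ((C * real d powr q) * (R powr \<eta>\<^sub>3 * \<epsilon> powr (- \<eta>\<^sub>3)))"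
    proof -
      have q: "real d powr \<eta>\<^sub>1 \<le> real d powr q" "real d powr \<eta>\<^sub>2 \<le> real d powr q" "1 \<le> real d powr q"
        using d h by (auto simp: q_def ge_one_powr_ge_zero intro!: powr_mono)
      have "real n\<^sub>1 * 1 \<le> real n\<^sub>1 * real d powr q" "\<kappa> * real d powr \<eta>\<^sub>2 \<le> \<kappa> * real d powr q"
        "(M * A powr \<eta>\<^sub>3) * real d powr \<eta>\<^sub>1 \<le> (M * A powr \<eta>\<^sub>3) * real d powr q"
        using mult_left_mono[OF q(3), of "real n\<^sub>1"] mult_left_mono[OF q(2), of \<kappa>]
          mult_left_mono[OF q(1), of "M * A powr \<eta>\<^sub>3"] h by auto
      then have "real n\<^sub>1 + real i0 + M * real d powr \<eta>\<^sub>1 * A powr \<eta>\<^sub>3 \<le> C * real d powr q"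
        using i0(2) q(3) by (simp add: C_def algebra_simps)
      then show ?thesis by (simp add: mult_right_mono)
    qed
    finally show ?thesis by (simp add: mult.assoc)
  qed
  moreover have "C \<ge> 0" "q \<ge> 0" using h by (auto simp: C_def q_def)
  ultimately show "polynomially_tractable cpx"
    unfolding polynomially_tractable_def using h(3)
    by (intro exI[of _ C] exI[of _ \<eta>\<^sub>3] exI[of _ q] exI[of _ "1::real"]) auto
qed

text \<open>From the cost to the sum: if the cost at \<open>T = R / \<epsilon>\<close> is at most \<open>exp (\<delta> (d + T))\<close>, then choosing
  \<open>T\<close> just above \<open>a / l d i\<close> bounds \<open>i\<close> by a constant times \<open>exp (\<delta> d + \<delta> a / l d i)\<close>. Squaring this
  estimate turns it into a bound for \<open>exp (- c / l d i)\<close> by a multiple of \<open>1 / i\<^sup>2\<close>, which sums. From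
  the sum to the cost, the number of weights above \<open>t\<close> is at most a constant times
  \<open>exp (c' d + c' / t)\<close>, and \<open>c'\<close> is small enough to leave half of the exponent for the constant.\<close>

theorem weakly_tractable_iff_exp_sum:
  "weakly_tractable cpx \<longleftrightarrow>
     (\<forall>c>0. (SUP d\<in>{1..}. ennreal (exp (- c * real d)) *
        (\<Sum>\<^sub>\<infinity>i\<in>{1..}. ennreal (exp (- c / l d i)))) < \<infinity>)"
proof (subst weakly_tractable_iff, erule (2) cpx_ge_1, intro iffI allI impI)
  fix c :: real assume "c > 0"
  define a where "a = A / (A - 1)"
  \<comment> \<open>The factor 2 comes from squaring; \<open>a > 1\<close> makes this choice small enough for the
    factor in the dimension as well.\<close>
  define \<delta> where "\<delta> = c / (2 * a)"
  define g where "g = (\<lambda>n. real n powr (- 2))"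
  have "a > 1" using A by (simp add: a_def)
  then have \<delta>: "\<delta> > 0" "2 * \<delta> \<le> c" "2 * (\<delta> * a) = c"
    using \<open>c > 0\<close> by (auto simp: \<delta>_def field_simps)
  have g: "summable g" unfolding g_def by (subst summable_real_powr_iff) simp
  assume tractable: "\<forall>c>0. \<exists>L. \<forall>d\<ge>1. \<forall>\<epsilon>>0. \<forall>R>0. real d + R / \<epsilon> \<ge> L \<longrightarrow>
      ereal_of_enat (cpx d \<epsilon> R) < ereal (exp (c * (real d + R / \<epsilon>)))"
  obtain L where "\<forall>d\<ge>1. \<forall>\<epsilon>>0. \<forall>R>0. real d + R / \<epsilon> \<ge> L \<longrightarrow>
      ereal_of_enat (cpx d \<epsilon> R) < ereal (exp (\<delta> * (real d + R / \<epsilon>)))"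
    using tractable[THEN spec, THEN mp, OF \<delta>(1)] by (rule exE)
  note L = this[rule_format]
  define B where "B = (1 + real n\<^sub>1) * exp (\<delta> * (1 + max L 0))"
  have term_le: "exp (- c / l d i) \<le> (B\<^sup>2 * exp (c * real d)) * g i" if d: "d \<ge> 1" and i: "i \<in> {1..}" for d i
  proof -
    have l: "l d i > 0" using d i by (simp add: l_pos)
    \<comment> \<open>The summand 1 gives a strict inequality, the summand \<open>max L 0\<close> reaches the asymptotic
      range.\<close>
    define T where "T = a / l d i + (1 + max L 0)"
    define E where "E = exp (\<delta> * (real d + T))"
    have "a / l d i > 0" using l \<open>a > 1\<close> by simp
    then have T: "T > a / l d i" "T \<ge> L" "T > 0" unfolding T_def by linarith+
    have "ereal_of_enat (cpx d 1 T) \<le> ereal E"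
      using L[of d 1 T] d T by (simp add: E_def)
    moreover have "l d i > a / T" using T l by (simp add: field_simps)
    ultimately have "real i \<le> E + real n\<^sub>1"
      using d i T by (intro count_le_cost[of d 1 T]) (auto simp: a_def)
    also have "\<dots> \<le> (1 + real n\<^sub>1) * E"
    proof -
      have "1 \<le> E" using \<delta> T by (simp add: E_def)
      then have "real n\<^sub>1 * 1 \<le> real n\<^sub>1 * E" by (intro mult_left_mono) auto
      then show ?thesis by (simp add: algebra_simps)
    qed
    also have "\<dots> = B * exp (\<delta> * real d) * exp (\<delta> * a / l d i)"
      by (simp add: B_def E_def T_def exp_add[symmetric] algebra_simps)
    finally have "(real i)\<^sup>2 \<le> (B * exp (\<delta> * real d) * exp (\<delta> * a / l d i))\<^sup>2"
      by (intro power_mono) auto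
    also have "\<dots> = B\<^sup>2 * exp (2 * \<delta> * real d) * exp (c / l d i)"
      using \<delta>(3)[symmetric] by (simp add: power_mult_distrib exp_double[symmetric] mult_ac)
    also have "\<dots> \<le> B\<^sup>2 * exp (c * real d) * exp (c / l d i)"
      using \<delta>(2) d by (intro mult_left_mono mult_right_mono) (auto simp: mult_right_mono)
    finally have "(real i)\<^sup>2 \<le> B\<^sup>2 * exp (c * real d) * exp (c / l d i)" .
    moreover have "exp (c / l d i) * exp (- c / l d i) = 1" by (simp add: exp_add[symmetric])
    ultimately have "(real i)\<^sup>2 * exp (- c / l d i) \<le> B\<^sup>2 * exp (c * real d)"
      using mult_right_mono[of "(real i)\<^sup>2" "B\<^sup>2 * exp (c * real d) * exp (c / l d i)" "exp (- c / l d i)"]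
      by (simp add: mult.assoc)
    then show ?thesis using i by (simp add: g_def powr_minus field_simps)
  qed
  have "ennreal (exp (- c * real d)) * (\<Sum>\<^sub>\<infinity>i\<in>{1..}. ennreal (exp (- c / l d i)))
      \<le> ennreal (B\<^sup>2 * suminf g)" if d: "d \<ge> 1" for d
  proof -
    have "(\<Sum>\<^sub>\<infinity>i\<in>{1..}. ennreal (exp (- c / l d i))) \<le> ennreal ((B\<^sup>2 * exp (c * real d)) * suminf g)"
      using term_le[OF d] by (intro infsum_ennreal_le_suminf g) (auto simp: g_def)
    also have "(B\<^sup>2 * exp (c * real d)) * suminf g = (B\<^sup>2 * suminf g) / exp (- c * real d)"
      by (simp add: exp_minus divide_inverse)
    finally show ?thesis
      using g by (subst ennreal_mult_le_iff_le_divide) (auto intro!: mult_nonneg_nonneg suminf_nonneg simp: g_def)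
  qed
  moreover have "B\<^sup>2 * suminf g \<ge> 0" using g by (intro mult_nonneg_nonneg suminf_nonneg) (auto simp: g_def)
  ultimately show "(SUP d\<in>{1..}. ennreal (exp (- c * real d)) *
        (\<Sum>\<^sub>\<infinity>i\<in>{1..}. ennreal (exp (- c / l d i)))) < \<infinity>"
    unfolding SUP_ennreal_finite_iff by auto
next
  fix c :: real assume "c > 0"
  define c' where "c' = c / (2 * A)"
  have c': "c' > 0" "c' \<le> c / 2" "c' * A = c / 2" using \<open>c > 0\<close> A by (auto simp: c'_def field_simps)
  assume "\<forall>c>0. (SUP d\<in>{1..}. ennreal (exp (- c * real d)) *
        (\<Sum>\<^sub>\<infinity>i\<in>{1..}. ennreal (exp (- c / l d i)))) < \<infinity>"
  then have "(SUP d\<in>{1..}. ennreal (exp (- c' * real d)) *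
        (\<Sum>\<^sub>\<infinity>i\<in>{1..}. ennreal (exp (- c' / l d i)))) < \<infinity>"
    using c'(1) by blast
  then obtain M where "M \<ge> 0" and M: "\<And>d. d \<ge> 1 \<Longrightarrow> ennreal (exp (- c' * real d)) *
        (\<Sum>\<^sub>\<infinity>i\<in>{1..}. ennreal (exp (- c' / l d i))) \<le> ennreal M"
    unfolding SUP_ennreal_finite_iff by auto
  define N where "N = real n\<^sub>1 + 1 + M"
  have "N > 0" using \<open>M \<ge> 0\<close> by (simp add: N_def)
  have "ereal_of_enat (cpx d \<epsilon> R) < ereal (exp (c * (real d + R / \<epsilon>)))"
    if d: "d \<ge> 1" and pos: "\<epsilon> > 0" "R > 0" and far: "real d + R / \<epsilon> \<ge> 2 / c * ln N + 1" for d \<epsilon> R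
  proof -
    define E where "E = exp (c / 2 * (real d + R / \<epsilon>))"
    have "E \<ge> 1" using \<open>c > 0\<close> d pos by (simp add: E_def add_nonneg_nonneg)
    have "(\<Sum>\<^sub>\<infinity>i\<in>{1..}. ennreal (exp (- c' / l d i))) \<le> ennreal (M / exp (- c' * real d))"
      using M[OF d] \<open>M \<ge> 0\<close> by (subst (asm) ennreal_mult_le_iff_le_divide) auto
    then have "ereal_of_enat (cpx d \<epsilon> R) \<le>
        ereal (max (real n\<^sub>1) (real 1 + M / exp (- c' * real d) / exp (- c' / (\<epsilon> / (A * R)))))"
      using d pos c' \<open>M \<ge> 0\<close>
      by (intro cost_le_of_sum[where g = "\<lambda>t. exp (- c' / t)"]) (auto simp: frac_le)
    also have "\<dots> \<le> ereal (N * E)"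
    proof -
      have "M / exp (- c' * real d) / exp (- c' / (\<epsilon> / (A * R))) = M * exp (c' * real d + c' * A * (R / \<epsilon>))"
        by (simp add: exp_minus exp_add field_simps)
      also have "\<dots> \<le> M * E"
      proof -
        have "c' * real d \<le> c / 2 * real d" using c' by (intro mult_right_mono) auto
        then have "c' * real d + c' * A * (R / \<epsilon>) \<le> c / 2 * (real d + R / \<epsilon>)"
          unfolding c'(3) by (simp add: distrib_left)
        then show ?thesis unfolding E_def using \<open>M \<ge> 0\<close> by (intro mult_left_mono) auto
      qed
      finally have 1: "M / exp (- c' * real d) / exp (- c' / (\<epsilon> / (A * R))) \<le> M * E" .
      have "real n\<^sub>1 * 1 \<le> real n\<^sub>1 * E" using \<open>E \<ge> 1\<close> by (intro mult_left_mono) auto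
      moreover have "M * E \<ge> 0" using \<open>M \<ge> 0\<close> \<open>E \<ge> 1\<close> by simp
      moreover have "N * E = real n\<^sub>1 * E + E + M * E" by (simp add: N_def algebra_simps)
      ultimately have "max (real n\<^sub>1) (real 1 + M / exp (- c' * real d) / exp (- c' / (\<epsilon> / (A * R)))) \<le> N * E"
        using 1 \<open>E \<ge> 1\<close> by simp
      then show ?thesis by simp
    qed
    also have "\<dots> < ereal (exp (c * (real d + R / \<epsilon>)))"
    proof -
      have "2 / c * ln N < real d + R / \<epsilon>" using far by simp
      then have "ln N < c / 2 * (real d + R / \<epsilon>)" using \<open>c > 0\<close> by (simp add: field_simps)
      then have "N < E" using \<open>N > 0\<close> unfolding E_def by (metis exp_less_cancel_iff exp_ln)
      then have "N * E < E * E" using \<open>E \<ge> 1\<close> by simp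
      also have "E * E = exp (c * (real d + R / \<epsilon>))" by (simp add: E_def exp_add[symmetric])
      finally show ?thesis by simp
    qed
    finally show ?thesis .
  qed
  then show "\<exists>L. \<forall>d\<ge>1. \<forall>\<epsilon>>0. \<forall>R>0. real d + R / \<epsilon> \<ge> L \<longrightarrow>
      ereal_of_enat (cpx d \<epsilon> R) < ereal (exp (c * (real d + R / \<epsilon>)))"
    by blast
qed

end

theorem theorem4:
  fixes K :: "nat \<Rightarrow> 'k set"
    and lam :: "nat \<Rightarrow> 'k \<Rightarrow> real"
    and e :: "nat \<Rightarrow> nat \<Rightarrow> 'k"
    and \<rho> \<tau> \<rho>' :: ennreal
    and A :: real
    and n\<^sub>1 :: nat
    and cpx :: "nat \<Rightarrow> real \<Rightarrow> real \<Rightarrow> enat"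
  assumes enum: "\<And>d. d \<ge> 1 \<Longrightarrow> bij_betw (e d) {1..} (K d)"
    and lam_pos: "\<And>d k. d \<ge> 1 \<Longrightarrow> k \<in> K d \<Longrightarrow> lam d k > 0"
    and lam_decr: "\<And>d i. d \<ge> 1 \<Longrightarrow> i \<ge> 1 \<Longrightarrow> lam d (e d (Suc i)) \<le> lam d (e d i)"
    and exponents: "1 \<le> \<tau>" "\<tau> \<le> \<rho>" "\<tau> \<le> \<rho>'" "1 / \<rho> + 1 / \<rho>' = 1 / \<tau>"
    and lam_norm: "\<And>d. d \<ge> 1 \<Longrightarrow> lp_norm \<rho>' {1..} (\<lambda>i. lam d (e d i)) < \<infinity>"
    and A: "A > 1"
    and n1: "n\<^sub>1 \<ge> 1"
    and eq: "\<rho> = \<tau>"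
    and cpx_def: "cpx = (\<lambda>d. COMP TYPE('a::real_normed_field) \<rho> \<tau> A n\<^sub>1 (K d) (lam d) (e d))"
  shows
    "(strongly_polynomially_tractable cpx \<longleftrightarrow>
        (\<exists>\<eta>>0. \<exists>i0\<ge>1. (SUP d\<in>{1..}. \<Sum>\<^sub>\<infinity>i\<in>{i0..}. ennreal (lam d (e d i) powr \<eta>)) < \<infinity>))
     \<and> (strongly_polynomially_tractable cpx \<longrightarrow>
          spt_exponent cpx =
            Inf {\<eta>. \<eta> > 0 \<and> (\<exists>i0\<ge>1. (SUP d\<in>{1..}. \<Sum>\<^sub>\<infinity>i\<in>{i0..}. ennreal (lam d (e d i) powr \<eta>)) < \<infinity>)})
     \<and> (polynomially_tractable cpx \<longleftrightarrow>
          (\<exists>\<eta>\<^sub>1 \<eta>\<^sub>2 \<eta>\<^sub>3 \<kappa> :: real. \<eta>\<^sub>1 \<ge> 0 \<and> \<eta>\<^sub>2 \<ge> 0 \<and> \<eta>\<^sub>3 > 0 \<and> \<kappa> > 0 \<and>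
             (SUP d\<in>{1..}. ennreal (real d powr (- \<eta>\<^sub>1)) *
                (\<Sum>\<^sub>\<infinity>i\<in>{nat \<lceil>\<kappa> * real d powr \<eta>\<^sub>2\<rceil>..}. ennreal (lam d (e d i) powr \<eta>\<^sub>3))) < \<infinity>))
     \<and> (weakly_tractable cpx \<longleftrightarrow>
          (\<forall>c>0. (SUP d\<in>{1..}. ennreal (exp (- c * real d)) *
                (\<Sum>\<^sub>\<infinity>i\<in>{1..}. ennreal (exp (- c / lam d (e d i))))) < \<infinity>))"
proof -
  have fixed_dimension: "cone_problem \<rho> A n\<^sub>1 (K d) (lam d) (e d)" if "d \<ge> 1" for d
    using that enum lam_pos lam_decr exponents(1) A n1 eq by unfold_locales auto
  interpret cost_sandwich cpx "\<lambda>d i. lam d (e d i)" A n\<^sub>1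
  proof
    show "A > 1" by (rule A)
    fix d i j :: nat assume d: "d \<ge> 1"
    interpret cone_problem \<rho> A n\<^sub>1 "K d" "lam d" "e d" using d by (rule fixed_dimension)
    show "lam d (e d i) > 0" if "i \<ge> 1" using that by (rule we_pos)
    show "lam d (e d j) \<le> lam d (e d i)" if "1 \<le> i" "i \<le> j" using that by (rule we_antimono)
    fix \<epsilon> R :: real and m assume pos: "\<epsilon> > 0" "R > 0"
    have cpx: "cpx d \<epsilon> R = COMP TYPE('a) \<rho> \<rho> A n\<^sub>1 (K d) (lam d) (e d) \<epsilon> R"
      by (simp add: cpx_def eq)
    show "1 \<le> cpx d \<epsilon> R" unfolding cpx using pos by (rule COMP_ge_1)
    show "enat j \<le> cpx d \<epsilon> R + enat n\<^sub>1" if "j \<ge> 1" "lam d (e d j) > A / (A - 1) * \<epsilon> / R"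
      unfolding cpx using pos that by (rule COMP_lower_bound)
    show "cpx d \<epsilon> R \<le> enat (max n\<^sub>1 m)"
      if "\<And>t. t > 0 \<Longrightarrow> \<exists>n. lam d (e d (Suc n)) \<le> t" "lam d (e d (Suc m)) \<le> \<epsilon> / (A * R)"
      unfolding cpx using that(1) pos that(2) by (rule COMP_upper_bound)
  qed
  show ?thesis
    using strongly_polynomially_tractable_iff spt_exponent_eq
      polynomially_tractable_iff weakly_tractable_iff_exp_sum
    unfolding summability_exponents_def by blast
qed

end
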